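(* Let assumptions (i), (ii'), (iii') (the last for the on-line case only) of the context hold, let $\epsilon>0$, and set $$\mu=\min\left(\frac{\epsilon}{2\sqrt6L\sqrt d},\frac{\epsilon}{\sqrt6n_0L(d+6)^{3/2}}\right),\quad\eta^k=\min\left(\frac1{2Ln_0},\frac{\epsilon}{Ln_0\|\mathbf{v}^k\|}\right),\quad K=\left\lfloor(4L\Delta n_0)\epsilon^{-2}\right\rfloor+1 .$$ In the on-line (infinite) case set $S_1=\frac{96d\sigma^2}{\epsilon^2}$, $S_2=\frac{30(2d+9)\sigma}{\epsilon n_0}$, $q=\frac{5n_0\sigma}{\epsilon}$, where $n_0\in[1,\frac{30(2d+9)\sigma}{\epsilon}]$. In the finite-sum case set $S_2=\frac{(2d+9)n^{1/2}}{n_0}$, $q=\frac{n_0n^{1/2}}6$, and $\mathcal{S}_1'=[n]$, i.e. $v_j^k=\frac{f(\mathbf{x}^k+\mu\mathbf{e}_j)-f(\mathbf{x}^k)}{\mu}$ for $j\in[d]$ whenever $k$ is a multiple of $q$, where $n_0\in[1,\frac{n^{1/2}}6]$. Then SPIDER-SZO (described in the context) outputs $\tilde{\mathbf{x}}$ with $$\mathbb{E}\left[\|\nabla f(\tilde{\mathbf{x}})\|\right]\le6\epsilon .$$ The number of IZO calls is $\mathcal{O}\left(d\min(n^{1/2}\epsilon^{-2},\epsilon^{-3})\right)$ (treating $\Delta,L,\sigma$ as constants).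
   Context: Setting: $f:\mathbb{R}^d\to\mathbb{R}$ is $f(\mathbf{x})=\mathbb{E}_i[f_i(\mathbf{x})]$; in the finite-sum case $i$ is uniform on $[n]=\{1,\dots,n\}$, so $f=\frac1n\sum_{i=1}^nf_i$; in the on-line case $i$ is a random index from a possibly infinite set. Each $f_i$ is differentiable, possibly non-convex, and $\mathbb{E}_i\nabla f_i=\nabla f$. An IZO (incremental zeroth-order oracle) call takes an index $i$ and a point $\mathbf{x}$ and returns $f_i(\mathbf{x})$. Assumptions: (i) $\Delta:=f(\mathbf{x}^0)-\inf f<\infty$; (ii') $\|\nabla f_i(\mathbf{x})-\nabla f_i(\mathbf{y})\|\le L\|\mathbf{x}-\mathbf{y}\|$ for all $i,\mathbf{x},\mathbf{y}$; (iii') (on-line case only) $\|\nabla f_i(\mathbf{x})-\nabla f(\mathbf{x})\|^2\le\sigma^2$ for all $i,\mathbf{x}$. SPIDER-SZO: for $k=0,1,\dots,K-1$: if $k$ is a multiple of $q$, draw a fresh multiset $\mathcal{S}_1'$ of $S_1'=S_1/d$ independent samples of $i$ (in the finite-sum case take $\mathcal{S}_1'=[n]$) and for each coordinate $j\in[d]$ set $$v_j^k=\frac1{S_1'}\sum_{i\in\mathcal{S}_1'}\frac{f_i(\mathbf{x}^k+\mu\mathbf{e}_j)-f_i(\mathbf{x}^k)}{\mu},$$ where $\mathbf{e}_j$ is the $j$-th standard basis vector and $\mathbf{v}^k=(v^k_1,\dots,v^k_d)$; otherwise draw a fresh multiset $\mathcal{S}_2$ of $S_2$ independent pairs $(i,\mathbf{u})$,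 with $\mathbf{u}\sim N(\mathbf{0},\mathbf{I}_d)$ independent of $i$, and set $$\mathbf{v}^k=\frac1{S_2}\sum_{(i,\mathbf{u})\in\mathcal{S}_2}\left(\frac{f_i(\mathbf{x}^k+\mu\mathbf{u})-f_i(\mathbf{x}^k)}{\mu}\mathbf{u}-\frac{f_i(\mathbf{x}^{k-1}+\mu\mathbf{u})-f_i(\mathbf{x}^{k-1})}{\mu}\mathbf{u}\right)+\mathbf{v}^{k-1}.$$ Then $\mathbf{x}^{k+1}=\mathbf{x}^k-\eta^k\mathbf{v}^k$. Output $\tilde{\mathbf{x}}$ uniformly at random from $\{\mathbf{x}^k\}_{k=0}^{K-1}$. The sample sizes and $q$ are treated as positive integers. The $\min$ in the IZO bound refers to using the better of the finite-sum setting ($\mathcal{O}(dn^{1/2}\epsilon^{-2})$) and the on-line setting ($\mathcal{O}(d\epsilon^{-3})$).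
   Formalization: The IZO bounds are proved for ε ≤ 1; the separate finite-sum bound O(d n^{1/2} ε^{-2}) only for n ≤ ε^{-4}, as the first full batch alone costs order nd calls; the min bound (better of both settings) holds for all n. Sample sizes and q are rounded up. *)

theory Defs
  imports "HOL-Probability.Probability" "HOL-Library.Multiset"
begin

section \<open>Stochastic objectives\<close>

definition gradient :: "('a::real_inner \<Rightarrow> real) \<Rightarrow> 'a \<Rightarrow> 'a" where
  "gradient h x = (THE D. GDERIV h x :> D)"

text \<open>
  The law of the random index \<open>i\<close> is a probability measure \<open>P\<close>. The finite-sum case is
  \<open>P = uniform_count_measure {1..n}\<close>.
\<close>

definition objective :: "'i measure \<Rightarrow> ('i \<Rightarrow> 'a \<Rightarrow> real) \<Rightarrow> 'a \<Rightarrow> real" where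
  "objective P f x = (\<integral>i. f i x \<partial>P)"

lemma objective_finite_sum:
  "objective (uniform_count_measure {1..n}) f x = (\<Sum>i=1..n. f i x) / real n"
  by (simp add: objective_def uniform_count_measure_def lebesgue_integral_point_measure_finite
      sum_divide_distrib)

definition smooth_problem ::
  "'i measure \<Rightarrow> ('i \<Rightarrow> 'a::euclidean_space \<Rightarrow> real) \<Rightarrow> real \<Rightarrow> bool" where
  "smooth_problem P f L \<longleftrightarrow>
     prob_space P \<and>
     (\<forall>i\<in>space P. \<forall>x. f i differentiable (at x)) \<and>
     (\<forall>x. integrable P (\<lambda>i. f i x)) \<and>
     (\<forall>x. integrable P (\<lambda>i. gradient (f i) x) \<and>
          (\<integral>i. gradient (f i) x \<partial>P) = gradient (objective P f) x) \<and>
     bdd_below (range (objective P f)) \<and>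
     (\<forall>i\<in>space P. \<forall>x y. norm (gradient (f i) x - gradient (f i) y) \<le> L * norm (x - y))"

definition bounded_noise ::
  "'i measure \<Rightarrow> ('i \<Rightarrow> 'a::euclidean_space \<Rightarrow> real) \<Rightarrow> real \<Rightarrow> bool" where
  "bounded_noise P f \<sigma> \<longleftrightarrow>
     (\<forall>i\<in>space P. \<forall>x. (norm (gradient (f i) x - gradient (objective P f) x))\<^sup>2 \<le> \<sigma>\<^sup>2)"

definition initial_gap :: "'i measure \<Rightarrow> ('i \<Rightarrow> 'a \<Rightarrow> real) \<Rightarrow> 'a \<Rightarrow> real" where
  "initial_gap P f x0 = objective P f x0 - (INF x. objective P f x)"


section \<open>The algorithm\<close>

definition coord_est ::
  "real \<Rightarrow> ('i \<Rightarrow> real^'d \<Rightarrow> real) \<Rightarrow> 'i multiset \<Rightarrow> real^'d \<Rightarrow> real^'d" where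
  "coord_est \<mu> f B x =
     (\<chi> j. 1 / real (size B) * (\<Sum>i\<in>#B. (f i (x + \<mu> *\<^sub>R axis j 1) - f i x) / \<mu>))"

definition gauss_diff ::
  "real \<Rightarrow> ('i \<Rightarrow> real^'d \<Rightarrow> real) \<Rightarrow> ('i \<times> (real^'d)) multiset \<Rightarrow> real^'d \<Rightarrow> real^'d \<Rightarrow> real^'d" where
  "gauss_diff \<mu> f S x y =
     (1 / real (size S)) *\<^sub>R
       (\<Sum>(i, u)\<in>#S. ((f i (x + \<mu> *\<^sub>R u) - f i x) / \<mu>) *\<^sub>R u
                   - ((f i (y + \<mu> *\<^sub>R u) - f i y) / \<mu>) *\<^sub>R u)"

text \<open>
  \<open>spider_szo f \<mu> \<eta> q B S x0 k\<close> is the pair of the \<open>k\<close>-th iterate and the \<open>k\<close>-th gradient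
  estimate. The multisets \<open>B k\<close> (indices) and \<open>S k\<close> (index-direction pairs) are the samples
  available at iteration \<open>k\<close>; only one of them is used there. The step size \<open>\<eta>\<close> may depend on
  the current estimate.
\<close>

primrec spider_szo ::
  "('i \<Rightarrow> real^'d \<Rightarrow> real) \<Rightarrow> real \<Rightarrow> (real^'d \<Rightarrow> real) \<Rightarrow> nat \<Rightarrow> (nat \<Rightarrow> 'i multiset) \<Rightarrow>
   (nat \<Rightarrow> ('i \<times> (real^'d)) multiset) \<Rightarrow> real^'d \<Rightarrow> nat \<Rightarrow> (real^'d) \<times> (real^'d)" where
  "spider_szo f \<mu> \<eta> q B S x0 0 = (x0, coord_est \<mu> f (B 0) x0)"
| "spider_szo f \<mu> \<eta> q B S x0 (Suc k) =
     (let (y, w) = spider_szo f \<mu> \<eta> q B S x0 k;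
          x = y - \<eta> w *\<^sub>R w
      in (x, if q dvd Suc k then coord_est \<mu> f (B (Suc k)) x
             else gauss_diff \<mu> f (S (Suc k)) x y + w))"

definition szo_iterate ::
  "('i \<Rightarrow> real^'d \<Rightarrow> real) \<Rightarrow> real \<Rightarrow> (real^'d \<Rightarrow> real) \<Rightarrow> nat \<Rightarrow> (nat \<Rightarrow> 'i multiset) \<Rightarrow>
   (nat \<Rightarrow> ('i \<times> (real^'d)) multiset) \<Rightarrow> real^'d \<Rightarrow> nat \<Rightarrow> real^'d" where
  "szo_iterate f \<mu> \<eta> q B S x0 k = fst (spider_szo f \<mu> \<eta> q B S x0 k)"

text \<open>
  The oracle calls (index, point) issued at iteration \<open>k\<close>, two for each difference quotient.
  Repeated points are not shared between quotients.
\<close>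

definition szo_queries ::
  "('i \<Rightarrow> real^'d \<Rightarrow> real) \<Rightarrow> real \<Rightarrow> (real^'d \<Rightarrow> real) \<Rightarrow> nat \<Rightarrow> (nat \<Rightarrow> 'i multiset) \<Rightarrow>
   (nat \<Rightarrow> ('i \<times> (real^'d)) multiset) \<Rightarrow> real^'d \<Rightarrow> nat \<Rightarrow> ('i \<times> (real^'d)) multiset" where
  "szo_queries f \<mu> \<eta> q B S x0 k =
     (let x = szo_iterate f \<mu> \<eta> q B S x0 k; y = szo_iterate f \<mu> \<eta> q B S x0 (k - 1)
      in if q dvd k
         then (\<Sum>i\<in>#B k. \<Sum>j\<in>UNIV. {#(i, x + \<mu> *\<^sub>R axis j 1), (i, x)#})
         else (\<Sum>(i, u)\<in>#S k. {#(i, x + \<mu> *\<^sub>R u), (i, x), (i, y + \<mu> *\<^sub>R u), (i, y)#}))"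

definition izo_calls ::
  "('i \<Rightarrow> real^'d \<Rightarrow> real) \<Rightarrow> real \<Rightarrow> (real^'d \<Rightarrow> real) \<Rightarrow> nat \<Rightarrow> (nat \<Rightarrow> 'i multiset) \<Rightarrow>
   (nat \<Rightarrow> ('i \<times> (real^'d)) multiset) \<Rightarrow> real^'d \<Rightarrow> nat \<Rightarrow> nat" where
  "izo_calls f \<mu> \<eta> q B S x0 K = (\<Sum>k<K. size (szo_queries f \<mu> \<eta> q B S x0 k))"

text \<open>
  The number of calls as a function of the dimension \<open>d\<close>, the batch sizes \<open>b\<close> and \<open>s\<close>, the
  period \<open>q\<close> and the number \<open>K\<close> of iterations. It has \<open>d\<close> as a natural number, so that
  bounds uniform in the dimension, which is a type in \<open>izo_calls\<close>, can be stated.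
\<close>

definition call_count :: "nat \<Rightarrow> nat \<Rightarrow> nat \<Rightarrow> nat \<Rightarrow> nat \<Rightarrow> nat" where
  "call_count d b s q K = (\<Sum>k<K. if q dvd k then 2 * d * b else 4 * s)"


section \<open>The randomness\<close>

definition std_gaussian :: "(real^'d) measure" where
  "std_gaussian = density lborel (\<lambda>u. ennreal (\<Prod>j\<in>UNIV. std_normal_density (u $ j)))"

text \<open>
  A sample path assigns to \<open>(k, s)\<close> the \<open>s\<close>-th index-direction pair drawn at iteration \<open>k\<close>; all
  pairs are independent. Where only indices are needed, the direction is ignored. The second
  component of \<open>szo_law\<close> is the independent, uniformly distributed number of the iterate that
  is output.
\<close>

definition szo_law ::
  "'i measure \<Rightarrow> nat \<Rightarrow> ((nat \<times> nat \<Rightarrow> 'i \<times> (real^'d)) \<times> nat) measure" where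
  "szo_law P K =
     (\<Pi>\<^sub>M z\<in>UNIV. P \<Otimes>\<^sub>M std_gaussian) \<Otimes>\<^sub>M uniform_count_measure {..<K}"

definition pair_batch ::
  "nat \<Rightarrow> (nat \<times> nat \<Rightarrow> 'i \<times> (real^'d)) \<Rightarrow> nat \<Rightarrow> ('i \<times> (real^'d)) multiset" where
  "pair_batch s \<omega> k = {#\<omega> (k, t). t \<in># mset_set {..<s}#}"

definition index_batch ::
  "nat \<Rightarrow> (nat \<times> nat \<Rightarrow> 'i \<times> (real^'d)) \<Rightarrow> nat \<Rightarrow> 'i multiset" where
  "index_batch b \<omega> k = image_mset fst (pair_batch b \<omega> k)"


section \<open>Parameters\<close>

definition szo_mu :: "nat \<Rightarrow> real \<Rightarrow> real \<Rightarrow> real \<Rightarrow> real" where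
  "szo_mu d L n0 \<epsilon> =
     min (\<epsilon> / (2 * sqrt 6 * L * sqrt (real d)))
         (\<epsilon> / (sqrt 6 * n0 * L * (real d + 6) powr (3/2)))"

text \<open>For \<open>v = 0\<close> the step size evaluates to \<open>0\<close>; the step \<open>\<eta> v *\<^sub>R v\<close> is \<open>0\<close> in any case.\<close>

definition szo_eta :: "real \<Rightarrow> real \<Rightarrow> real \<Rightarrow> 'a::real_normed_vector \<Rightarrow> real" where
  "szo_eta L n0 \<epsilon> v = min (1 / (2 * L * n0)) (\<epsilon> / (L * n0 * norm v))"

definition szo_K :: "real \<Rightarrow> real \<Rightarrow> real \<Rightarrow> real \<Rightarrow> nat" where
  "szo_K L \<Delta> n0 \<epsilon> = nat \<lfloor>4 * L * \<Delta> * n0 / \<epsilon>\<^sup>2\<rfloor> + 1"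

text \<open>
  Sample sizes and periods are rounded up to integers, which changes nothing when the given value
  is a positive integer. \<open>online_S1'\<close> is the number of indices drawn, \<open>S\<^sub>1 / d\<close> with
  \<open>S\<^sub>1 = 96 d \<sigma>\<^sup>2 / \<epsilon>\<^sup>2\<close>.
\<close>

definition online_S1' :: "real \<Rightarrow> real \<Rightarrow> nat" where
  "online_S1' \<sigma> \<epsilon> = nat \<lceil>96 * \<sigma>\<^sup>2 / \<epsilon>\<^sup>2\<rceil>"

definition online_S2 :: "nat \<Rightarrow> real \<Rightarrow> real \<Rightarrow> real \<Rightarrow> nat" where
  "online_S2 d \<sigma> n0 \<epsilon> = nat \<lceil>30 * (2 * real d + 9) * \<sigma> / (\<epsilon> * n0)\<rceil>"

definition online_q :: "real \<Rightarrow> real \<Rightarrow> real \<Rightarrow> nat" where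
  "online_q \<sigma> n0 \<epsilon> = nat \<lceil>5 * n0 * \<sigma> / \<epsilon>\<rceil>"

definition online_n0_range :: "nat \<Rightarrow> real \<Rightarrow> real \<Rightarrow> real set" where
  "online_n0_range d \<sigma> \<epsilon> = {1..30 * (2 * real d + 9) * \<sigma> / \<epsilon>}"

definition finite_S2 :: "nat \<Rightarrow> nat \<Rightarrow> real \<Rightarrow> nat" where
  "finite_S2 d n n0 = nat \<lceil>(2 * real d + 9) * sqrt (real n) / n0\<rceil>"

definition finite_q :: "nat \<Rightarrow> real \<Rightarrow> nat" where
  "finite_q n n0 = nat \<lceil>n0 * sqrt (real n) / 6\<rceil>"

definition finite_n0_range :: "nat \<Rightarrow> real set" where
  "finite_n0_range n = {1..sqrt (real n) / 6}"

definition online_calls :: "nat \<Rightarrow> real \<Rightarrow> real \<Rightarrow> real \<Rightarrow> real \<Rightarrow> real \<Rightarrow> nat" where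
  "online_calls d L \<Delta> \<sigma> n0 \<epsilon> =
     call_count d (online_S1' \<sigma> \<epsilon>) (online_S2 d \<sigma> n0 \<epsilon>) (online_q \<sigma> n0 \<epsilon>) (szo_K L \<Delta> n0 \<epsilon>)"

definition finite_calls :: "nat \<Rightarrow> nat \<Rightarrow> real \<Rightarrow> real \<Rightarrow> real \<Rightarrow> real \<Rightarrow> nat" where
  "finite_calls d n L \<Delta> n0 \<epsilon> =
     call_count d n (finite_S2 d n n0) (finite_q n n0) (szo_K L \<Delta> n0 \<epsilon>)"

end

theory Submission
  imports Defs
begin

text \<open>
  The estimate \<open>v\<^sup>k\<close> stays within order \<open>\<epsilon>\<close> of \<open>\<nabla>F(x\<^sup>k)\<close> in mean square, and a step along such an
  estimate decreases \<open>F\<close> unless the gradient is of order \<open>\<epsilon>\<close>; a bounded gap allows few decreases.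

  A correction step averages differences of Gaussian difference quotients.
  Their mean is not a difference of gradients of the objective \<open>F\<close>, but of the field
  \<open>smoothed \<mu> x\<close>, the mean of a single quotient at \<open>x\<close>. Hence \<open>v\<^sup>k - smoothed \<mu> x\<^sup>k\<close>, and not
  \<open>v\<^sup>k - \<nabla>F(x\<^sup>k)\<close>, is a martingale between two resets: its second moment grows in each step only
  by the variance of the new average, which is at most the second moment of one difference divided
  by the batch size. Since both quotients of a difference use the same direction \<open>u\<close>, the
  difference is \<open>(a \<bullet> u) u\<close>, with \<open>a\<close> a difference of two gradients, up to Taylor remainders of
  order \<open>\<mu>\<close>. Its second moment is at most \<open>6 d (L |x - y|)\<^sup>2\<close>, linear in the dimension, plus a term
  that the choice of \<open>\<mu>\<close> keeps of order \<open>(\<epsilon> / n\<^sub>0)\<^sup>2\<close> (\<open>gauss_quotient_diff_sq\<close>). The step size keeps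
  \<open>|x\<^sup>k\<^sup>+\<^sup>1 - x\<^sup>k|\<close> below \<open>\<epsilon> / (L n\<^sub>0)\<close>, so the at most \<open>q - 1\<close> corrections after a reset add at
  most \<open>\<epsilon>\<^sup>2 / 2\<close>. The error of the reset and the distance from \<open>smoothed\<close> to \<open>\<nabla>F\<close> are of order
  \<open>\<epsilon>\<^sup>2\<close> as well, and \<open>estimator_error\<close> results: the mean square of \<open>v\<^sup>k - \<nabla>F(x\<^sup>k)\<close> is at most
  \<open>23/12 \<epsilon>\<^sup>2\<close>.

  The step size is truncated so that a step decreases \<open>F\<close> by an amount linear in the norm
  of \<open>v\<^sup>k\<close>, up to \<open>\<epsilon>\<^sup>2\<close> and the squared error (\<open>descent\<close>). This inequality holds on every
  sample path. It telescopes, the total decrease is at most the initial gap, and the choice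
  of \<open>K\<close> makes the average gradient norm of order \<open>\<epsilon>\<close>.

  All samples are coordinates of one product measure. Conditioning on the past is
  replaced by redrawing a single coordinate (\<open>nn_integral_PiM_resample\<close>): functions that ignore this
  coordinate are unaffected, so the conditional statements become statements about one
  integral over one fresh sample.

  The number of oracle calls does not depend on the samples; its bounds are elementary.
\<close>

section \<open>Gradients of smooth functions\<close>

text \<open>
  A derivative is represented by the vector of its values on the orthonormal basis, so the
  description in the definition of \<open>gradient\<close> denotes this vector.
\<close>

lemma GDERIV_gradient:
  fixes h :: "'a::euclidean_space \<Rightarrow> real"
  assumes "h differentiable (at x)"
  shows "GDERIV h x :> gradient h x"
proof -
  obtain D where D: "(h has_derivative D) (at x)"
    using assms by (auto simp: differentiable_def)
  have "D = (\<lambda>v. v \<bullet> (\<Sum>b\<in>Basis. D b *\<^sub>R b))"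
  proof
    fix v
    interpret bounded_linear D using D by (rule has_derivative_bounded_linear)
    have "D v = D (\<Sum>b\<in>Basis. (v \<bullet> b) *\<^sub>R b)" by (simp add: euclidean_representation)
    also have "\<dots> = (\<Sum>b\<in>Basis. (v \<bullet> b) * D b)" by (simp add: sum scaleR)
    finally show "D v = v \<bullet> (\<Sum>b\<in>Basis. D b *\<^sub>R b)"
      by (simp add: inner_sum_right mult.commute)
  qed
  then have ex: "GDERIV h x :> (\<Sum>b\<in>Basis. D b *\<^sub>R b)"
    using D by (simp add: gderiv_def)
  have "c = e" if "GDERIV h x :> c" "GDERIV h x :> e" for c e
  proof -
    have "(\<lambda>v. v \<bullet> c) = (\<lambda>v. v \<bullet> e)"
      using that unfolding gderiv_def by (rule has_derivative_unique)
    then show ?thesis by (metis vector_eq_ldot)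
  qed
  with ex show ?thesis unfolding gradient_def by (rule_tac theI) 
qed

text \<open>
  Along the segment from \<open>x\<close> to \<open>y\<close>, the difference of \<open>h\<close> and the quadratic upper model is
  nonincreasing, because its derivative is bounded by the Lipschitz condition.
\<close>

lemma smooth_quadratic_upper:
  fixes h :: "'a::euclidean_space \<Rightarrow> real"
  assumes diff: "\<And>x. h differentiable (at x)"
    and lip: "\<And>x y. norm (gradient h x - gradient h y) \<le> L * norm (x - y)"
  shows "h y - h x - gradient h x \<bullet> (y - x) \<le> L / 2 * (norm (y - x))\<^sup>2"
proof -
  define w where "w = y - x"
  define \<phi> where "\<phi> t = h (x + t *\<^sub>R w) - t * (gradient h x \<bullet> w) - L / 2 * t\<^sup>2 * (norm w)\<^sup>2" for t
  have "\<phi> 1 \<le> \<phi> 0"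
  proof (rule DERIV_nonpos_imp_nonincreasing[of 0 1])
    fix t :: real assume t: "0 \<le> t"
    have "((\<lambda>t. h (x + t *\<^sub>R w)) has_derivative (\<lambda>s. (s *\<^sub>R w) \<bullet> gradient h (x + t *\<^sub>R w))) (at t)"
      by (rule has_derivative_compose[of _ "\<lambda>s. s *\<^sub>R w"])
        (use GDERIV_gradient[OF diff] in \<open>auto simp: gderiv_def intro!: derivative_eq_intros\<close>)
    then have "((\<lambda>t. h (x + t *\<^sub>R w)) has_real_derivative (gradient h (x + t *\<^sub>R w) \<bullet> w)) (at t)"
      by (simp add: has_field_derivative_def inner_commute mult_commute_abs)
    note * = this
    have "(\<phi> has_real_derivative (gradient h (x + t *\<^sub>R w) \<bullet> w - gradient h x \<bullet> w - L * t * (norm w)\<^sup>2)) (at t)"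
      unfolding \<phi>_def by (rule derivative_eq_intros * refl | simp)+
    moreover have "(gradient h (x + t *\<^sub>R w) - gradient h x) \<bullet> w \<le> L * t * (norm w)\<^sup>2"
    proof -
      have "(gradient h (x + t *\<^sub>R w) - gradient h x) \<bullet> w
          \<le> norm (gradient h (x + t *\<^sub>R w) - gradient h x) * norm w"
        by (rule norm_cauchy_schwarz)
      also have "\<dots> \<le> (L * norm (x + t *\<^sub>R w - x)) * norm w"
        by (intro mult_right_mono lip) auto
      finally show ?thesis using t by (simp add: power2_eq_square mult_ac)
    qed
    ultimately show "\<exists>y. (\<phi> has_real_derivative y) (at t) \<and> y \<le> 0"
      by (auto simp: inner_diff_left intro!: exI)
  qed simp
  then show ?thesis unfolding \<phi>_def w_def by simp
qed

lemma gradient_minus: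
  fixes h :: "'a::euclidean_space \<Rightarrow> real"
  assumes "h differentiable (at x)"
  shows "gradient (\<lambda>x. - h x) x = - gradient h x"
proof -
  have "GDERIV (\<lambda>x. - h x) x :> - gradient h x"
    by (rule GDERIV_minus[OF GDERIV_gradient[OF assms]])
  moreover have "GDERIV (\<lambda>x. - h x) x :> gradient (\<lambda>x. - h x) x"
    by (rule GDERIV_gradient) (use assms in auto)
  ultimately have "(\<lambda>v. v \<bullet> (- gradient h x)) = (\<lambda>v. v \<bullet> gradient (\<lambda>x. - h x) x)"
    unfolding gderiv_def by (rule has_derivative_unique)
  then show ?thesis by (metis vector_eq_ldot)
qed

text \<open>
  The lower bound is the upper bound for \<open>- h\<close>.
\<close>

lemma smooth_quadratic:
  fixes h :: "'a::euclidean_space \<Rightarrow> real"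
  assumes diff: "\<And>x. h differentiable (at x)"
    and lip: "\<And>x y. norm (gradient h x - gradient h y) \<le> L * norm (x - y)"
  shows "\<bar>h y - h x - gradient h x \<bullet> (y - x)\<bar> \<le> L / 2 * (norm (y - x))\<^sup>2"
proof -
  have "- h y - - h x - gradient (\<lambda>x. - h x) x \<bullet> (y - x) \<le> L / 2 * (norm (y - x))\<^sup>2"
  proof (rule smooth_quadratic_upper)
    fix x y
    have "norm (- gradient h x - - gradient h y) = norm (gradient h x - gradient h y)"
      by (metis minus_diff_minus norm_minus_cancel)
    then show "norm (gradient (\<lambda>x. - h x) x - gradient (\<lambda>x. - h x) y) \<le> L * norm (x - y)"
      using lip[of x y] diff by (simp add: gradient_minus)
  qed (use diff in auto)
  then have "- (h y - h x - gradient h x \<bullet> (y - x)) \<le> L / 2 * (norm (y - x))\<^sup>2"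
    by (simp add: gradient_minus diff)
  with smooth_quadratic_upper[OF assms, of y x] show ?thesis
    by (rule abs_leI)
qed

section \<open>Joint measurability\<close>

text \<open>
  With simple functions \<open>G n\<close> tending to the identity, \<open>f i (G n x)\<close> takes only finitely many points
  as second argument, hence is jointly measurable, and by continuity it tends to \<open>f i x\<close>.
\<close>

lemma borel_measurable_caratheodory:
  fixes f :: "'i \<Rightarrow> 'a::euclidean_space \<Rightarrow> 'b::metric_space"
  assumes meas: "\<And>x. (\<lambda>i. f i x) \<in> borel_measurable P"
    and cont: "\<And>i. i \<in> space P \<Longrightarrow> continuous_on UNIV (f i)"
  shows "(\<lambda>(i, x). f i x) \<in> borel_measurable (P \<Otimes>\<^sub>M borel)"
proof -
  obtain G :: "nat \<Rightarrow> 'a \<Rightarrow> 'a" where G: "\<And>n. simple_function borel (G n)"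
    "\<And>x. (\<lambda>n. G n x) \<longlonglongrightarrow> x"
    using borel_measurable_implies_sequence_metric[of "\<lambda>x::'a. x" borel 0] by auto
  show ?thesis
  proof (rule borel_measurable_LIMSEQ_metric)
    fix n
    show "(\<lambda>(i, x). f i (G n x)) \<in> borel_measurable (P \<Otimes>\<^sub>M borel)"
      unfolding case_prod_beta
    proof (rule measurable_compose_countable'[where I="range (G n)"])
      show "(\<lambda>z. G n (snd z)) \<in> P \<Otimes>\<^sub>M borel \<rightarrow>\<^sub>M count_space (range (G n))"
        using measurable_simple_function[OF G(1)[of n]] G(1)[of n]
        by (intro measurable_compose[OF measurable_snd])
          (auto simp: measurable_count_space_eq2 simple_function_def)
      show "countable (range (G n))"
        using G(1)[of n] by (auto simp: simple_function_def countable_finite)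
    qed (use meas in \<open>measurable\<close>)
  next
    fix z assume "z \<in> space (P \<Otimes>\<^sub>M borel :: ('i \<times> 'a) measure)"
    then have "continuous_on UNIV (f (fst z))" by (auto simp: space_pair_measure intro: cont)
    then have "(\<lambda>n. f (fst z) (G n (snd z))) \<longlonglongrightarrow> f (fst z) (snd z)"
      by (rule continuous_on_tendsto_compose[OF _ G(2)]) auto
    then show "(\<lambda>n. case z of (i, x) \<Rightarrow> f i (G n x)) \<longlonglongrightarrow> (case z of (i, x) \<Rightarrow> f i x)"
      by (simp add: case_prod_beta)
  qed
qed

section \<open>Fresh samples and second moments\<close>

text \<open>
  A coordinate of a product of probability spaces can be redrawn independently without changing
  the law. A function that ignores coordinate \<open>z\<close> is the same before and after the update, which
  makes this a form of Fubini's theorem that leaves the index set of the product alone.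
\<close>

lemma nn_integral_PiM_resample:
  assumes "prob_space M" and h: "h \<in> borel_measurable (\<Pi>\<^sub>M z\<in>UNIV. M)"
  shows "(\<integral>\<^sup>+w. h w \<partial>(\<Pi>\<^sub>M z\<in>UNIV. M)) = (\<integral>\<^sup>+w. (\<integral>\<^sup>+p. h (w(z := p)) \<partial>M) \<partial>(\<Pi>\<^sub>M z\<in>UNIV. M))"
proof -
  let ?\<Omega> = "\<Pi>\<^sub>M z\<in>UNIV. M"
  interpret M: prob_space M by fact
  interpret O: prob_space ?\<Omega> by (intro prob_space_PiM assms)
  interpret pair_sigma_finite M ?\<Omega> ..
  have u: "(\<lambda>(p, w). w(z := p)) \<in> M \<Otimes>\<^sub>M ?\<Omega> \<rightarrow>\<^sub>M ?\<Omega>"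
    using measurable_fun_upd[of UNIV UNIV z snd "M \<Otimes>\<^sub>M ?\<Omega>" "\<lambda>_. M" fst]
    by (simp add: case_prod_beta)
  have "distr (M \<Otimes>\<^sub>M ?\<Omega>) ?\<Omega> (\<lambda>(p, w). w(z := p)) = ?\<Omega>"
    using distr_pair_PiM_eq_PiM[of UNIV "\<lambda>_. M" z] assms by simp
  then have "(\<integral>\<^sup>+w. h w \<partial>?\<Omega>) = (\<integral>\<^sup>+w. h w \<partial>distr (M \<Otimes>\<^sub>M ?\<Omega>) ?\<Omega> (\<lambda>(p, w). w(z := p)))"
    by simp
  also have "\<dots> = (\<integral>\<^sup>+x. h ((\<lambda>(p, w). w(z := p)) x) \<partial>(M \<Otimes>\<^sub>M ?\<Omega>))"
    by (rule nn_integral_distr[OF u]) (use h in simp)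
  also have "\<dots> = (\<integral>\<^sup>+w. (\<integral>\<^sup>+p. h (w(z := p)) \<partial>M) \<partial>?\<Omega>)"
    by (subst nn_integral_snd[symmetric]) (use measurable_compose[OF u h] in \<open>auto simp: case_prod_beta\<close>)
  finally show ?thesis .
qed

lemma nn_integral_norm_sq_add_centred:
  fixes Z :: "'p \<Rightarrow> 'a::euclidean_space"
  assumes "prob_space M" and int: "integrable M Z" and mean: "(\<integral>p. Z p \<partial>M) = 0"
    and sq: "(\<integral>\<^sup>+p. ennreal ((norm (Z p))\<^sup>2) \<partial>M) \<le> ennreal c"
  shows "(\<integral>\<^sup>+p. ennreal ((norm (a + Z p))\<^sup>2) \<partial>M) \<le> ennreal ((norm a)\<^sup>2) + ennreal c"
proof -
  interpret prob_space M by fact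
  have [measurable]: "Z \<in> borel_measurable M" using int by auto
  have isq: "integrable M (\<lambda>p. (norm (Z p))\<^sup>2)"
    by (rule integrableI_nonneg) (use sq in \<open>auto intro: le_less_trans\<close>)
  have ia: "integrable M (\<lambda>p. 2 * (a \<bullet> Z p))" using int by auto
  have eq: "(norm (a + Z p))\<^sup>2 = (norm a)\<^sup>2 + 2 * (a \<bullet> Z p) + (norm (Z p))\<^sup>2" for p
    by (simp add: power2_norm_eq_inner inner_add_left inner_add_right inner_commute)
  have I: "integrable M (\<lambda>p. (norm (a + Z p))\<^sup>2)" unfolding eq
    by (intro Bochner_Integration.integrable_add isq ia) auto
  have "(\<integral>\<^sup>+p. ennreal ((norm (a + Z p))\<^sup>2) \<partial>M) = ennreal (\<integral>p. (norm (a + Z p))\<^sup>2 \<partial>M)"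
    by (rule nn_integral_eq_integral[OF I]) auto
  also have "(\<integral>p. (norm (a + Z p))\<^sup>2 \<partial>M) = (norm a)\<^sup>2 + (\<integral>p. (norm (Z p))\<^sup>2 \<partial>M)"
    unfolding eq using isq ia int mean by (simp add: prob_space)
  also have "ennreal \<dots> = ennreal ((norm a)\<^sup>2) + (\<integral>\<^sup>+p. ennreal ((norm (Z p))\<^sup>2) \<partial>M)"
    by (simp add: nn_integral_eq_integral[OF isq])
  also have "\<dots> \<le> ennreal ((norm a)\<^sup>2) + ennreal c" by (intro add_left_mono sq)
  finally show ?thesis .
qed

text \<open>
  Given the samples outside block \<open>k\<close>, the terms \<open>Z w (w (k, t))\<close> are independent and centred, so that their
  second moments add up and there is no cross term with \<open>A\<close>. The terms are redrawn one by one.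
\<close>

lemma nn_integral_norm_sq_fresh_sum:
  fixes A :: "(nat \<times> nat \<Rightarrow> 'p) \<Rightarrow> 'a::euclidean_space"
    and Z :: "(nat \<times> nat \<Rightarrow> 'p) \<Rightarrow> 'p \<Rightarrow> 'a"
  defines "\<Omega> M \<equiv> (\<Pi>\<^sub>M z\<in>(UNIV :: (nat \<times> nat) set). M)"
  assumes M: "prob_space M"
    and A [measurable]: "A \<in> borel_measurable (\<Omega> M)"
    and Z [measurable]: "(\<lambda>(w, p). Z w p) \<in> borel_measurable (\<Omega> M \<Otimes>\<^sub>M M)"
    and A_old: "\<And>w t p. A (w((k, t) := p)) = A w"
    and Z_old: "\<And>w t p. Z (w((k, t) := p)) = Z w"
    and int: "\<And>w. w \<in> space (\<Omega> M) \<Longrightarrow> integrable M (Z w)"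
    and mean: "\<And>w. w \<in> space (\<Omega> M) \<Longrightarrow> (\<integral>p. Z w p \<partial>M) = 0"
    and sq: "\<And>w. w \<in> space (\<Omega> M) \<Longrightarrow> (\<integral>\<^sup>+p. ennreal ((norm (Z w p))\<^sup>2) \<partial>M) \<le> ennreal c"
    and "0 \<le> c"
  shows "(\<integral>\<^sup>+w. ennreal ((norm (A w + (\<Sum>t<s. Z w (w (k, t)))))\<^sup>2) \<partial>\<Omega> M)
      \<le> (\<integral>\<^sup>+w. ennreal ((norm (A w))\<^sup>2) \<partial>\<Omega> M) + ennreal (real s * c)"
proof (induction s)
  case 0
  then show ?case by simp
next
  case (Suc s)
  interpret M: prob_space M by fact
  interpret O: prob_space "\<Omega> M" unfolding \<Omega>_def by (intro prob_space_PiM M)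
  define Y where "Y w = A w + (\<Sum>t<s. Z w (w (k, t)))" for w
  have c [measurable]: "(\<lambda>w. w z) \<in> \<Omega> M \<rightarrow>\<^sub>M M" for z
    unfolding \<Omega>_def by (rule measurable_component_singleton) simp
  have Zc [measurable]: "(\<lambda>w. Z w (w z)) \<in> borel_measurable (\<Omega> M)" for z
    using measurable_compose[OF measurable_Pair[OF measurable_ident_sets[OF refl] c] Z] by simp
  have Y [measurable]: "Y \<in> borel_measurable (\<Omega> M)" unfolding Y_def by measurable
  have "(\<integral>\<^sup>+w. ennreal ((norm (A w + (\<Sum>t<Suc s. Z w (w (k, t)))))\<^sup>2) \<partial>\<Omega> M)
      = (\<integral>\<^sup>+w. ennreal ((norm (Y w + Z w (w (k, s))))\<^sup>2) \<partial>\<Omega> M)"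
    by (simp add: Y_def add.assoc)
  also have "\<dots> = (\<integral>\<^sup>+w. (\<integral>\<^sup>+p. ennreal ((norm (Y w + Z w p))\<^sup>2) \<partial>M) \<partial>\<Omega> M)"
    unfolding \<Omega>_def
    by (subst nn_integral_PiM_resample[OF M, of _ "(k, s)"])
      (auto simp: Z_old Y_def A_old \<Omega>_def[symmetric])
  also have "\<dots> \<le> (\<integral>\<^sup>+w. ennreal ((norm (Y w))\<^sup>2) + ennreal c \<partial>\<Omega> M)"
    by (intro nn_integral_mono nn_integral_norm_sq_add_centred M int mean sq)
  also have "\<dots> = (\<integral>\<^sup>+w. ennreal ((norm (Y w))\<^sup>2) \<partial>\<Omega> M) + ennreal c"
    by (simp add: nn_integral_add O.emeasure_space_1)
  also have "\<dots> \<le> ((\<integral>\<^sup>+w. ennreal ((norm (A w))\<^sup>2) \<partial>\<Omega> M) + ennreal (real s * c)) + ennreal c"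
    using Suc.IH unfolding Y_def by (intro add_right_mono)
  also have "\<dots> = (\<integral>\<^sup>+w. ennreal ((norm (A w))\<^sup>2) \<partial>\<Omega> M) + ennreal (real (Suc s) * c)"
    using \<open>0 \<le> c\<close> by (simp add: add.assoc distrib_right add.commute flip: ennreal_plus)
  finally show ?case .
qed
lemma norm_add_sq_le: "(norm (a + b :: 'a::real_inner))\<^sup>2 \<le> 2 * (norm a)\<^sup>2 + 2 * (norm b)\<^sup>2"
proof -
  have "(norm (a + b))\<^sup>2 + (norm (a - b))\<^sup>2 = 2 * (norm a)\<^sup>2 + 2 * (norm b)\<^sup>2"
    by (simp add: power2_norm_eq_inner inner_add_left inner_add_right inner_diff_left inner_diff_right)
  then show ?thesis using zero_le_power2[of "norm (a - b)"] by linarith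
qed

lemma nn_integral_variance_le:
  fixes D :: "'p \<Rightarrow> 'a::euclidean_space"
  assumes "prob_space M" and int: "integrable M D"
    and sq: "(\<integral>\<^sup>+p. ennreal ((norm (D p))\<^sup>2) \<partial>M) \<le> ennreal c" and "0 \<le> c"
  shows "(\<integral>\<^sup>+p. ennreal ((norm (D p - (\<integral>p. D p \<partial>M)))\<^sup>2) \<partial>M) \<le> ennreal c"
proof -
  interpret prob_space M by fact
  define e where "e = (\<integral>p. D p \<partial>M)"
  have [measurable]: "D \<in> borel_measurable M" using int by auto
  have isq: "integrable M (\<lambda>p. (norm (D p))\<^sup>2)"
    by (rule integrableI_nonneg) (use sq in \<open>auto intro: le_less_trans\<close>)
  have ie: "integrable M (\<lambda>p. 2 * (D p \<bullet> e))" using int by auto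
  have eq: "(norm (D p - e))\<^sup>2 = (norm (D p))\<^sup>2 - 2 * (D p \<bullet> e) + (norm e)\<^sup>2" for p
    by (simp add: power2_norm_eq_inner inner_diff_left inner_diff_right inner_commute)
  have I: "integrable M (\<lambda>p. (norm (D p - e))\<^sup>2)" unfolding eq
    by (intro Bochner_Integration.integrable_add Bochner_Integration.integrable_diff isq ie) auto
  have "(\<integral>p. (norm (D p - e))\<^sup>2 \<partial>M) = (\<integral>p. (norm (D p))\<^sup>2 \<partial>M) - 2 * (e \<bullet> e) + (norm e)\<^sup>2"
    unfolding eq using isq ie int by (simp add: prob_space e_def)
  also have "\<dots> \<le> (\<integral>p. (norm (D p))\<^sup>2 \<partial>M)" by (simp add: power2_norm_eq_inner)
  also have "\<dots> \<le> c"
    using sq \<open>0 \<le> c\<close> by (simp add: nn_integral_eq_integral[OF isq])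
  finally have "ennreal (\<integral>p. (norm (D p - e))\<^sup>2 \<partial>M) \<le> ennreal c" by (rule ennreal_leI)
  then show ?thesis unfolding e_def[symmetric] by (simp add: nn_integral_eq_integral[OF I])
qed

lemma norm_integral_le:
  fixes h :: "'p \<Rightarrow> 'b::{banach, second_countable_topology}"
  assumes "integrable M h" "integrable M g" "\<And>x. x \<in> space M \<Longrightarrow> norm (h x) \<le> g x"
  shows "norm (\<integral>x. h x \<partial>M) \<le> (\<integral>x. g x \<partial>M)"
  by (rule order_trans[OF integral_norm_bound integral_mono]) (use assms in auto)

lemma nn_integral_norm_add_sq_le:
  fixes a b :: "'w \<Rightarrow> 'a::euclidean_space"
  assumes "prob_space N" and [measurable]: "a \<in> borel_measurable N"
    and a: "(\<integral>\<^sup>+w. ennreal ((norm (a w))\<^sup>2) \<partial>N) \<le> ennreal c"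
    and b: "\<And>w. w \<in> space N \<Longrightarrow> (norm (b w))\<^sup>2 \<le> e" and "0 \<le> c" "0 \<le> e"
  shows "(\<integral>\<^sup>+w. ennreal ((norm (a w + b w))\<^sup>2) \<partial>N) \<le> ennreal (2 * c + 2 * e)"
proof -
  interpret prob_space N by fact
  have "(norm (a w + b w))\<^sup>2 \<le> 2 * (norm (a w))\<^sup>2 + 2 * e" if "w \<in> space N" for w
    using norm_add_sq_le[of "a w" "b w"] b[OF that] by linarith
  then have "(\<integral>\<^sup>+w. ennreal ((norm (a w + b w))\<^sup>2) \<partial>N)
      \<le> (\<integral>\<^sup>+w. ennreal 2 * ennreal ((norm (a w))\<^sup>2) + ennreal (2 * e) \<partial>N)"
    using \<open>0 \<le> e\<close> by (intro nn_integral_mono)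
      (simp add: ennreal_mult[symmetric] ennreal_plus[symmetric] ennreal_leI
        flip: ennreal_numeral del: ennreal_plus)
  also have "\<dots> = ennreal 2 * (\<integral>\<^sup>+w. ennreal ((norm (a w))\<^sup>2) \<partial>N) + ennreal (2 * e)"
    by (simp add: nn_integral_add nn_integral_cmult emeasure_space_1)
  also have "\<dots> \<le> ennreal 2 * ennreal c + ennreal (2 * e)"
    by (intro add_right_mono mult_left_mono a) simp
  finally show ?thesis
    using assms(5,6) by (simp add: ennreal_mult ennreal_plus)
qed

section \<open>Moments of the standard Gaussian\<close>

lemma sets_std_gaussian [simp, measurable_cong]: "sets std_gaussian = sets borel"
  by (simp add: std_gaussian_def)

lemma space_std_gaussian [simp]: "space std_gaussian = UNIV"
  by (simp add: std_gaussian_def)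

lemma borel_measurable_vec_nth [measurable (raw)]:
  fixes h :: "'a \<Rightarrow> real^'d"
  assumes "h \<in> borel_measurable M"
  shows "(\<lambda>x. h x $ j) \<in> borel_measurable M"
proof -
  have "(\<lambda>x. h x \<bullet> axis j 1) \<in> borel_measurable M" using assms by measurable
  then show ?thesis by (simp add: inner_axis)
qed

lemma borel_measurable_vec_lambda [measurable (raw)]:
  fixes h :: "'a \<Rightarrow> 'd::finite \<Rightarrow> real"
  assumes "\<And>j. (\<lambda>x. h x j) \<in> borel_measurable M"
  shows "(\<lambda>x. \<chi> j. h x j) \<in> borel_measurable M"
  unfolding borel_measurable_euclidean_space[of "\<lambda>x. \<chi> j. h x j"]
  using assms by (auto simp: Basis_vec_def inner_axis)

lemma nn_integral_std_gaussian_prod: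
  fixes h :: "'d::finite \<Rightarrow> real \<Rightarrow> ennreal"
  assumes [measurable]: "\<And>j. h j \<in> borel_measurable borel"
  shows "(\<integral>\<^sup>+u. (\<Prod>j\<in>UNIV. h j (u $ j)) \<partial>(std_gaussian :: (real^'d) measure))
    = (\<Prod>j\<in>UNIV. \<integral>\<^sup>+x. ennreal (std_normal_density x) * h j x \<partial>lborel)"
proof -
  have B: "(Basis :: (real^'d) set) = (\<lambda>j. axis j 1) ` UNIV" by (auto simp: Basis_vec_def)
  have inj: "inj (\<lambda>j. axis j (1::real) :: real^'d)" by (auto simp: inj_def axis_eq_axis)
  let ?F = "\<lambda>j x. ennreal (std_normal_density x) * h j x"
  have "(\<integral>\<^sup>+u. (\<Prod>j\<in>UNIV. h j (u $ j)) \<partial>(std_gaussian :: (real^'d) measure))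
     = (\<integral>\<^sup>+u. (\<Prod>j\<in>UNIV. ?F j (u $ j)) \<partial>lborel)"
    unfolding std_gaussian_def
    by (subst nn_integral_density) (auto simp: prod.distrib prod_ennreal)
  also have "\<dots> = (\<integral>\<^sup>+u. (\<Prod>b\<in>Basis. ?F (axis_index b) (u \<bullet> b)) \<partial>(lborel :: (real^'d) measure))"
    unfolding B by (simp add: prod.reindex[OF inj] inner_axis axis_index_axis)
  also have "\<dots> = (\<Prod>b\<in>(Basis :: (real^'d) set). \<integral>\<^sup>+x. ?F (axis_index b) x \<partial>lborel)"
    by (rule nn_integral_lborel_prod) auto
  also have "\<dots> = (\<Prod>j\<in>UNIV. \<integral>\<^sup>+x. ?F j x \<partial>lborel)"
    unfolding B by (simp add: prod.reindex[OF inj] axis_index_axis)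
  finally show ?thesis .
qed

lemma nn_integral_std_normal_even:
  "(\<integral>\<^sup>+x. ennreal (std_normal_density x) * ennreal (x ^ (2 * m)) \<partial>lborel)
     = ennreal (fact (2 * m) / (2 ^ m * fact m))"
proof -
  have "(\<integral>\<^sup>+x. ennreal (std_normal_density x * x ^ (2 * m)) \<partial>lborel)
     = ennreal (fact (2 * m) / (2 ^ m * fact m))"
    using std_normal_moment_even[of m]
    by (subst nn_integral_eq_integral)
      (auto simp: has_bochner_integral_iff zero_le_even_power)
  then show ?thesis by (simp add: ennreal_mult zero_le_even_power)
qed

lemma nn_integral_std_gaussian_even:
  "(\<integral>\<^sup>+u. ennreal ((u $ k) ^ (2 * m)) \<partial>(std_gaussian :: (real^'d) measure))
    = ennreal (fact (2 * m) / (2 ^ m * fact m))"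
proof -
  let ?h = "\<lambda>j x. if j = k then ennreal (x ^ (2 * m)) else 1"
  have "(\<integral>\<^sup>+u. ennreal ((u $ k) ^ (2 * m)) \<partial>(std_gaussian :: (real^'d) measure))
      = (\<integral>\<^sup>+u. (\<Prod>j\<in>UNIV. ?h j (u $ j)) \<partial>(std_gaussian :: (real^'d) measure))"
    by (simp add: prod.delta if_distrib cong: if_cong)
  also have "\<dots> = (\<Prod>j\<in>UNIV. \<integral>\<^sup>+x. ennreal (std_normal_density x) * ?h j x \<partial>lborel)"
    by (rule nn_integral_std_gaussian_prod) auto
  also have "\<dots> = (\<Prod>j\<in>UNIV. if j = k then ennreal (fact (2 * m) / (2 ^ m * fact m)) else 1)"
    using nn_integral_std_normal_even[of 0]
    by (intro prod.cong) (auto simp: nn_integral_std_normal_even)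
  finally show ?thesis by (simp add: prod.delta)
qed

lemma prob_space_std_gaussian: "prob_space (std_gaussian :: (real^'d) measure)"
  using nn_integral_std_gaussian_even[of "undefined::'d" 0] by (intro prob_spaceI) simp

lemma std_gaussian_even_moment:
  shows "integrable (std_gaussian :: (real^'d) measure) (\<lambda>u. (u $ k) ^ (2 * m))"
    and "(\<integral>u. (u $ k) ^ (2 * m) \<partial>(std_gaussian :: (real^'d) measure)) = fact (2 * m) / (2 ^ m * fact m)"
proof -
  show "integrable (std_gaussian :: (real^'d) measure) (\<lambda>u. (u $ k) ^ (2 * m))"
    by (rule integrableI_nonneg) (auto simp: nn_integral_std_gaussian_even zero_le_even_power)
  show "(\<integral>u. (u $ k) ^ (2 * m) \<partial>(std_gaussian :: (real^'d) measure)) = fact (2 * m) / (2 ^ m * fact m)"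
    by (subst integral_eq_nn_integral) (auto simp: nn_integral_std_gaussian_even zero_le_even_power)
qed

lemma norm_vec_power2: "(norm (u :: real^'d))\<^sup>2 = (\<Sum>j\<in>UNIV. (u $ j)\<^sup>2)"
  unfolding power2_norm_eq_inner by (simp add: inner_vec_def power2_eq_square)

lemma norm_vec_pow4_le: "norm (u :: real^'d) ^ 4 \<le> real CARD('d) * (\<Sum>j\<in>UNIV. (u $ j) ^ 4)"
proof -
  have "norm u ^ 4 = (\<Sum>j\<in>UNIV. (u $ j)\<^sup>2)\<^sup>2"
    by (simp flip: norm_vec_power2 power_mult)
  also have "\<dots> \<le> (\<Sum>j\<in>UNIV. ((u $ j)\<^sup>2)\<^sup>2) * real CARD('d)"
    using sum_squared_le_sum_of_squares[of "\<lambda>j. (u $ j)\<^sup>2" "UNIV :: 'd set"] by simp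
  finally show ?thesis by (simp add: mult.commute flip: power_mult)
qed

text \<open>On the nonnegative reals, the cube lies above its tangent at the mean \<open>s\<close> of the \<open>a j\<close>.\<close>

lemma sum_cube_le:
  fixes a :: "'b \<Rightarrow> real"
  assumes "finite A" and a: "\<And>j. j \<in> A \<Longrightarrow> 0 \<le> a j"
  shows "(\<Sum>j\<in>A. a j) ^ 3 \<le> (real (card A))\<^sup>2 * (\<Sum>j\<in>A. a j ^ 3)"
proof (cases "A = {}")
  case False
  define n where "n = real (card A)"
  define s where "s = (\<Sum>j\<in>A. a j) / n"
  have n: "n > 0" using False assms by (simp add: n_def card_gt_0_iff)
  have s: "s \<ge> 0" unfolding s_def using a n by (intro divide_nonneg_pos sum_nonneg) auto
  have *: "s ^ 3 + 3 * s\<^sup>2 * (a j - s) \<le> a j ^ 3" if "j \<in> A" for j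
  proof -
    have "a j ^ 3 - (s ^ 3 + 3 * s\<^sup>2 * (a j - s)) = (a j - s)\<^sup>2 * (a j + 2 * s)"
      by (simp add: power2_eq_square power3_eq_cube algebra_simps)
    moreover have "\<dots> \<ge> 0" using a[OF that] s by simp
    ultimately show ?thesis by linarith
  qed
  have "n * s ^ 3 = (\<Sum>j\<in>A. s ^ 3 + 3 * s\<^sup>2 * (a j - s))"
    using n by (simp add: sum.distrib sum_subtractf n_def[symmetric] s_def flip: sum_distrib_left)
  also have "\<dots> \<le> (\<Sum>j\<in>A. a j ^ 3)" by (intro sum_mono *)
  finally have "n\<^sup>2 * (n * s ^ 3) \<le> n\<^sup>2 * (\<Sum>j\<in>A. a j ^ 3)" by (intro mult_left_mono) auto
  moreover have "n\<^sup>2 * (n * s ^ 3) = (\<Sum>j\<in>A. a j) ^ 3"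
    using n by (simp add: s_def power_divide power2_eq_square power3_eq_cube)
  ultimately show ?thesis by (simp add: n_def)
qed simp

lemma norm_vec_pow6_le: "norm (u :: real^'d) ^ 6 \<le> (real CARD('d))\<^sup>2 * (\<Sum>j\<in>UNIV. (u $ j) ^ 6)"
proof -
  have "norm u ^ 6 = (\<Sum>j\<in>UNIV. (u $ j)\<^sup>2) ^ 3"
    by (simp flip: norm_vec_power2 power_mult)
  also have "\<dots> \<le> (real CARD('d))\<^sup>2 * (\<Sum>j\<in>UNIV. ((u $ j)\<^sup>2) ^ 3)"
    by (rule sum_cube_le) auto
  finally show ?thesis by (simp flip: power_mult)
qed

text \<open>
  A name for the Gaussian measure fixes the dimension, which the integrands below do not
  always determine.
\<close>

context
  fixes G :: "(real^'d) measure"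
  assumes G_def: "G = std_gaussian"
begin

lemma gaussian_coord_moment2: "integrable G (\<lambda>u. (u $ k)\<^sup>2)" "(\<integral>u. (u $ k)\<^sup>2 \<partial>G) = 1"
  using std_gaussian_even_moment[of "k::'d" 1] by (simp_all add: G_def)

lemma gaussian_coord_moment4: "integrable G (\<lambda>u. (u $ k) ^ 4)" "(\<integral>u. (u $ k) ^ 4 \<partial>G) = 3"
  using std_gaussian_even_moment[of "k::'d" 2] by (simp_all add: G_def fact_numeral)

lemma gaussian_coord_moment6: "integrable G (\<lambda>u. (u $ k) ^ 6)" "(\<integral>u. (u $ k) ^ 6 \<partial>G) = 15"
  using std_gaussian_even_moment[of "k::'d" 3] by (simp_all add: G_def fact_numeral)

lemma sets_gaussian_measure [simp, measurable_cong]: "sets G = sets borel" by (simp add: G_def)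

lemma gaussian_norm_moment2: "integrable G (\<lambda>u. (norm u)\<^sup>2)" "(\<integral>u. (norm u)\<^sup>2 \<partial>G) = real CARD('d)"
  unfolding norm_vec_power2 using gaussian_coord_moment2 by simp_all

lemma gaussian_norm_moment4: "integrable G (\<lambda>u. norm u ^ 4)" "(\<integral>u. norm u ^ 4 \<partial>G) \<le> 3 * (real CARD('d))\<^sup>2"
proof -
  have I: "integrable G (\<lambda>u. real CARD('d) * (\<Sum>j\<in>UNIV. (u $ j) ^ 4))"
    using gaussian_coord_moment4 by simp
  show *: "integrable G (\<lambda>u. norm u ^ 4)"
    by (rule Bochner_Integration.integrable_bound[OF I])
      (auto intro!: always_eventually order_trans[OF norm_vec_pow4_le] simp del: of_nat_sum)
  have "(\<integral>u. norm u ^ 4 \<partial>G) \<le> (\<integral>u. real CARD('d) * (\<Sum>j\<in>UNIV. (u $ j) ^ 4) \<partial>G)"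
    by (rule integral_mono[OF * I norm_vec_pow4_le])
  also have "\<dots> = 3 * (real CARD('d))\<^sup>2" using gaussian_coord_moment4 by (simp add: power2_eq_square)
  finally show "(\<integral>u. norm u ^ 4 \<partial>G) \<le> 3 * (real CARD('d))\<^sup>2" .
qed

lemma gaussian_norm_moment6: "integrable G (\<lambda>u. norm u ^ 6)" "(\<integral>u. norm u ^ 6 \<partial>G) \<le> 15 * (real CARD('d)) ^ 3"
proof -
  have I: "integrable G (\<lambda>u. (real CARD('d))\<^sup>2 * (\<Sum>j\<in>UNIV. (u $ j) ^ 6))"
    using gaussian_coord_moment6 by simp
  show *: "integrable G (\<lambda>u. norm u ^ 6)"
    by (rule Bochner_Integration.integrable_bound[OF I])
      (auto intro!: always_eventually order_trans[OF norm_vec_pow6_le])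
  have "(\<integral>u. norm u ^ 6 \<partial>G) \<le> (\<integral>u. (real CARD('d))\<^sup>2 * (\<Sum>j\<in>UNIV. (u $ j) ^ 6) \<partial>G)"
    by (rule integral_mono[OF * I norm_vec_pow6_le])
  also have "\<dots> = 15 * (real CARD('d)) ^ 3"
    using gaussian_coord_moment6 by (simp add: power2_eq_square power3_eq_cube)
  finally show "(\<integral>u. norm u ^ 6 \<partial>G) \<le> 15 * (real CARD('d)) ^ 3" .
qed

text \<open>
  The bound on the square is the product of those for the second and the fourth moment, as in the
  Cauchy--Schwarz inequality.
\<close>

lemma gaussian_norm_moment3: "integrable G (\<lambda>u. norm u ^ 3)" "(\<integral>u. norm u ^ 3 \<partial>G)\<^sup>2 \<le> 3 * (real CARD('d)) ^ 3"
proof -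
  define d where "d = real CARD('d)"
  \<comment> \<open>the weight for which both terms of the bound \<open>le\<close> below have the same mean\<close>
  define c where "c = sqrt (3 * d)"
  have d: "d > 0" by (simp add: d_def)
  then have c: "c > 0" "c * c = 3 * d" by (auto simp: c_def)
  have le: "norm u ^ 3 \<le> (c * (norm u)\<^sup>2 + norm u ^ 4 / c) / 2" for u :: "real^'d"
  proof -
    have "0 \<le> (norm u)\<^sup>2 * (c - norm u)\<^sup>2 / c" using c by simp
    also have "\<dots> = c * (norm u)\<^sup>2 + norm u ^ 4 / c - 2 * norm u ^ 3"
      using c by (simp add: field_simps power2_eq_square power3_eq_cube power4_eq_xxxx)
    finally show ?thesis by simp
  qed
  have I: "integrable G (\<lambda>u. (c * (norm u)\<^sup>2 + norm u ^ 4 / c) / 2)"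
    using gaussian_norm_moment2 gaussian_norm_moment4 by simp
  show *: "integrable G (\<lambda>u. norm u ^ 3)"
    by (rule Bochner_Integration.integrable_bound[OF I])
      (use le in \<open>auto intro!: always_eventually order_trans[OF _ abs_ge_self]\<close>)
  have "(\<integral>u. norm u ^ 3 \<partial>G) \<le> (\<integral>u. (c * (norm u)\<^sup>2 + norm u ^ 4 / c) / 2 \<partial>G)"
    by (rule integral_mono[OF * I le])
  also have "\<dots> = (c * d + (\<integral>u. norm u ^ 4 \<partial>G) / c) / 2"
    using gaussian_norm_moment2 gaussian_norm_moment4 by (simp add: d_def)
  also have "\<dots> \<le> (c * d + (3 * d\<^sup>2) / c) / 2"
    using gaussian_norm_moment4 c by (simp add: divide_right_mono d_def)
  also have "\<dots> = c * d"
    using c by (simp add: field_simps power2_eq_square)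
  finally have "(\<integral>u. norm u ^ 3 \<partial>G)\<^sup>2 \<le> (c * d)\<^sup>2"
    by (intro power_mono) (auto intro!: integral_nonneg_AE)
  also have "\<dots> = 3 * d ^ 3" using c by (simp add: power2_eq_square power3_eq_cube) 
  finally show "(\<integral>u. norm u ^ 3 \<partial>G)\<^sup>2 \<le> 3 * (real CARD('d)) ^ 3" by (simp add: d_def)
qed

text \<open>
  Changing the sign of one coordinate preserves the Gaussian law, so moments that are odd in some
  coordinate vanish.
\<close>

definition reflect :: "'d \<Rightarrow> real^'d \<Rightarrow> real^'d" where
  "reflect k u = (\<chi> j. if j = k then - u $ j else u $ j)"

lemma reflect_measurable [measurable]: "reflect k \<in> borel \<rightarrow>\<^sub>M borel"
  unfolding reflect_def by measurable

lemma distr_reflect: "distr G borel (reflect k) = G"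
proof -
  define c :: "real^'d \<Rightarrow> real" where "c b = (if b = axis k 1 then - 1 else 1)" for b
  have T: "0 + (\<Sum>j\<in>Basis. (c j * (u \<bullet> j)) *\<^sub>R j) = reflect k u" for u
  proof (subst vec_eq_iff, intro allI)
    fix i
    have "(0 + (\<Sum>j\<in>Basis. (c j * (u \<bullet> j)) *\<^sub>R j)) $ i
        = (\<Sum>j\<in>Basis. (c j * (u \<bullet> j)) *\<^sub>R j) \<bullet> axis i 1" by (simp add: inner_axis)
    also have "\<dots> = c (axis i 1) * (u \<bullet> axis i 1)"
      by (subst inner_sum_left_Basis) auto
    finally show "(0 + (\<Sum>j\<in>Basis. (c j * (u \<bullet> j)) *\<^sub>R j)) $ i = reflect k u $ i"
      by (simp add: c_def reflect_def inner_axis axis_eq_axis)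
  qed
  have "lborel = density (distr lborel borel (reflect k)) (\<lambda>_. (\<Prod>j\<in>Basis. \<bar>c j\<bar>))"
    using lborel_affine_euclidean[of c 0] unfolding T by (simp add: c_def)
  also have "(\<Prod>j\<in>Basis. \<bar>c j\<bar>) = 1" by (rule prod.neutral) (simp add: c_def)
  finally have L: "distr lborel borel (reflect k) = lborel" by (simp add: density_1)
  let ?D = "\<lambda>u::real^'d. ennreal (\<Prod>j\<in>UNIV. std_normal_density (u $ j))"
  have inv: "?D (reflect k u) = ?D u" for u
    by (intro arg_cong[where f=ennreal] prod.cong) (auto simp: reflect_def normal_density_def)
  have "distr G borel (reflect k) = distr (density lborel (\<lambda>u. ?D (reflect k u))) borel (reflect k)"
    unfolding G_def std_gaussian_def inv ..
  also have "\<dots> = density (distr lborel borel (reflect k)) ?D"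
    by (subst density_distr) auto
  finally show ?thesis by (simp add: L G_def std_gaussian_def)
qed

lemma integral_reflect_odd:
  assumes h [measurable]: "h \<in> borel_measurable borel" and odd: "\<And>u. h (reflect k u) = - h u"
  shows "(\<integral>u. h u \<partial>G) = (0::real)"
proof -
  have "(\<integral>u. h u \<partial>G) = (\<integral>u. h u \<partial>distr G borel (reflect k))" by (simp add: distr_reflect)
  also have "\<dots> = (\<integral>u. h (reflect k u) \<partial>G)" by (rule integral_distr) auto
  finally show ?thesis by (simp add: odd)
qed

text \<open>
  In the double sum for \<open>(a \<bullet> u) * (b \<bullet> u)\<close> the terms off the diagonal are odd in a coordinate.
\<close>

lemma gaussian_bilinear_moment:
  fixes w :: "real^'d \<Rightarrow> real" and a b :: "real^'d"
  assumes w [measurable]: "w \<in> borel_measurable borel" and even: "\<And>k u. w (reflect k u) = w u"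
    and int: "integrable G (\<lambda>u. (norm u)\<^sup>2 * w u)" and nonneg: "\<And>u. 0 \<le> w u"
  shows "(\<integral>u. (a \<bullet> u) * (b \<bullet> u) * w u \<partial>G) = (\<Sum>k\<in>UNIV. a $ k * b $ k * (\<integral>u. (u $ k)\<^sup>2 * w u \<partial>G))"
proof -
  have I: "integrable G (\<lambda>u. u $ k * u $ l * w u)" for k l
  proof (rule Bochner_Integration.integrable_bound[OF int])
    have "\<bar>u $ k * u $ l * w u\<bar> \<le> (norm u)\<^sup>2 * w u" for u
      using component_le_norm_cart[of u k] component_le_norm_cart[of u l] nonneg[of u]
      by (auto simp: abs_mult power2_eq_square intro!: mult_right_mono mult_mono)
    then show "AE u in G. norm (u $ k * u $ l * w u) \<le> norm ((norm u)\<^sup>2 * w u)"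
      by (intro always_eventually) (auto simp: abs_mult nonneg)
  qed auto
  have Z: "(\<integral>u. u $ k * u $ l * w u \<partial>G) = 0" if "k \<noteq> l" for k l
    by (rule integral_reflect_odd[of _ k]) (use that even in \<open>auto simp: reflect_def\<close>)
  have "(\<integral>u. (a \<bullet> u) * (b \<bullet> u) * w u \<partial>G)
      = (\<integral>u. (\<Sum>k\<in>UNIV. \<Sum>l\<in>UNIV. a $ k * b $ l * (u $ k * u $ l * w u)) \<partial>G)"
    by (intro Bochner_Integration.integral_cong refl)
      (simp only: inner_vec_def inner_real_def sum_product, simp add: sum_distrib_left sum_distrib_right mult_ac)
  also have "\<dots> = (\<Sum>k\<in>UNIV. \<Sum>l\<in>UNIV. a $ k * b $ l * (\<integral>u. u $ k * u $ l * w u \<partial>G))"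
    using I by (simp add: Bochner_Integration.integral_sum)
  also have "\<dots> = (\<Sum>k\<in>UNIV. \<Sum>l\<in>UNIV. if l = k then a $ k * b $ k * (\<integral>u. (u $ k)\<^sup>2 * w u \<partial>G) else 0)"
    by (intro sum.cong) (auto simp: Z power2_eq_square)
  finally show ?thesis by simp
qed

lemma gaussian_inner_direction: "integrable G (\<lambda>u. (a \<bullet> u) *\<^sub>R u)" "(\<integral>u. (a \<bullet> u) *\<^sub>R u \<partial>G) = a"
proof -
  show I: "integrable G (\<lambda>u. (a \<bullet> u) *\<^sub>R u)"
  proof (rule Bochner_Integration.integrable_bound)
    show "integrable G (\<lambda>u. norm a * (norm u)\<^sup>2)" using gaussian_norm_moment2 by simp
    show "AE u in G. norm ((a \<bullet> u) *\<^sub>R u) \<le> norm (norm a * (norm u)\<^sup>2)"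
      by (auto simp: power2_eq_square abs_mult mult.assoc[symmetric]
          intro!: always_eventually mult_right_mono Cauchy_Schwarz_ineq2)
  qed auto
  have "(\<integral>u. (a \<bullet> u) *\<^sub>R u \<partial>G) \<bullet> b = a \<bullet> b" for b
  proof -
    have "(\<integral>u. (a \<bullet> u) *\<^sub>R u \<partial>G) \<bullet> b = (\<integral>u. ((a \<bullet> u) *\<^sub>R u) \<bullet> b \<partial>G)"
      by (rule integral_inner_left[symmetric]) (use I in auto)
    also have "\<dots> = (\<integral>u. (a \<bullet> u) * (b \<bullet> u) * 1 \<partial>G)" by (simp add: inner_commute)
    also have "\<dots> = a \<bullet> b"
      by (subst gaussian_bilinear_moment) (use gaussian_coord_moment2 gaussian_norm_moment2 in \<open>auto simp: inner_vec_def\<close>)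
    finally show ?thesis .
  qed
  then show "(\<integral>u. (a \<bullet> u) *\<^sub>R u \<partial>G) = a" using vector_eq_rdot by blast
qed

text \<open>
  Cauchy--Schwarz on the integrand would give \<open>E|u|\<^sup>4\<close>, of order \<open>d\<^sup>2\<close>. Only one direction of \<open>u\<close>
  counts in \<open>a \<bullet> u\<close>, and the bound is linear in \<open>d\<close>; this is why batches of a size linear
  in \<open>d\<close> suffice.
\<close>

lemma gaussian_inner_norm_sq: "(\<integral>\<^sup>+u. ennreal ((a \<bullet> u)\<^sup>2 * (norm u)\<^sup>2) \<partial>G) \<le> ennreal (3 * real CARD('d) * (norm a)\<^sup>2)"
proof -
  have n4: "(norm u)\<^sup>2 * (norm u)\<^sup>2 = norm u ^ 4" for u :: "real^'d" by (simp flip: power_add)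
  have I: "integrable G (\<lambda>u. (a \<bullet> u)\<^sup>2 * (norm u)\<^sup>2)"
  proof (rule Bochner_Integration.integrable_bound)
    show "integrable G (\<lambda>u. (norm a)\<^sup>2 * norm u ^ 4)" using gaussian_norm_moment4 by simp
    have "(a \<bullet> u)\<^sup>2 * (norm u)\<^sup>2 \<le> (norm a)\<^sup>2 * norm u ^ 4" for u
      using mult_right_mono[OF Cauchy_Schwarz_ineq[of a u], of "(norm u)\<^sup>2"]
      by (simp add: n4[symmetric] power2_norm_eq_inner mult.assoc)
    then show "AE u in G. norm ((a \<bullet> u)\<^sup>2 * (norm u)\<^sup>2) \<le> norm ((norm a)\<^sup>2 * norm u ^ 4)"
      by (intro always_eventually) (simp add: abs_mult)
  qed auto
  have even: "(norm (reflect k u))\<^sup>2 = (norm u)\<^sup>2" for k u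
    unfolding norm_vec_power2 by (rule sum.cong) (auto simp: reflect_def)
  have M: "(\<integral>u. (u $ k)\<^sup>2 * (norm u)\<^sup>2 \<partial>G) \<le> 3 * real CARD('d)" for k
  proof -
    have le: "(u $ k)\<^sup>2 * (norm u)\<^sup>2 \<le> (\<Sum>j\<in>UNIV. ((u $ k) ^ 4 + (u $ j) ^ 4) / 2)" for u
    proof -
      have "(u $ k)\<^sup>2 * (u $ j)\<^sup>2 \<le> ((u $ k) ^ 4 + (u $ j) ^ 4) / 2" for j
        using sum_squares_bound[of "(u $ k)\<^sup>2" "(u $ j)\<^sup>2"] by (simp flip: power_mult)
      then show ?thesis unfolding norm_vec_power2 sum_distrib_left by (intro sum_mono)
    qed
    have J: "integrable G (\<lambda>u. \<Sum>j\<in>UNIV. ((u $ k) ^ 4 + (u $ j) ^ 4) / 2)"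
      using gaussian_coord_moment4 by simp
    have "(\<integral>u. (u $ k)\<^sup>2 * (norm u)\<^sup>2 \<partial>G) \<le> (\<integral>u. (\<Sum>j\<in>UNIV. ((u $ k) ^ 4 + (u $ j) ^ 4) / 2) \<partial>G)"
      by (rule integral_mono'[OF J le]) (auto intro!: sum_nonneg)
    also have "\<dots> = 3 * real CARD('d)" using gaussian_coord_moment4 by (simp add: Bochner_Integration.integral_sum)
    finally show ?thesis .
  qed
  have "(\<integral>\<^sup>+u. ennreal ((a \<bullet> u)\<^sup>2 * (norm u)\<^sup>2) \<partial>G) = ennreal (\<integral>u. (a \<bullet> u) * (a \<bullet> u) * (norm u)\<^sup>2 \<partial>G)"
    using nn_integral_eq_integral[OF I] by (simp add: power2_eq_square)
  also have "(\<integral>u. (a \<bullet> u) * (a \<bullet> u) * (norm u)\<^sup>2 \<partial>G)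
      = (\<Sum>k\<in>UNIV. a $ k * a $ k * (\<integral>u. (u $ k)\<^sup>2 * (norm u)\<^sup>2 \<partial>G))"
    by (rule gaussian_bilinear_moment) (use gaussian_norm_moment4 in \<open>auto simp: even n4\<close>)
  also have "\<dots> \<le> (\<Sum>k\<in>UNIV. a $ k * a $ k * (3 * real CARD('d)))"
    by (intro sum_mono mult_left_mono M) simp
  also have "\<dots> = 3 * real CARD('d) * (norm a)\<^sup>2"
    unfolding norm_vec_power2 sum_distrib_left by (simp add: power2_eq_square mult_ac)
  finally show ?thesis by (simp add: ennreal_leI)
qed

end
section \<open>Gaussian difference quotients\<close>

definition gauss_quotient :: "real \<Rightarrow> ('i \<Rightarrow> real^'d \<Rightarrow> real) \<Rightarrow> real^'d \<Rightarrow> 'i \<times> (real^'d) \<Rightarrow> real^'d" where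
  "gauss_quotient \<mu> f x p = ((f (fst p) (x + \<mu> *\<^sub>R snd p) - f (fst p) x) / \<mu>) *\<^sub>R snd p"

locale stochastic_objective =
  fixes P :: "'i measure" and f :: "'i \<Rightarrow> real^'d \<Rightarrow> real" and L :: real
  assumes smooth: "smooth_problem P f L" and L_pos: "0 < L"
begin

abbreviation "F \<equiv> objective P f"
abbreviation "F' \<equiv> gradient F"
abbreviation "\<gamma> \<equiv> (std_gaussian :: (real^'d) measure)"
abbreviation "M \<equiv> P \<Otimes>\<^sub>M \<gamma>"

sublocale P: prob_space P using smooth by (simp add: smooth_problem_def)
sublocale \<gamma>: prob_space \<gamma> by (rule prob_space_std_gaussian)
sublocale M: pair_prob_space P \<gamma> ..

lemma sets_gaussian [measurable_cong]: "sets \<gamma> = sets borel" by simp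

lemma diff: "i \<in> space P \<Longrightarrow> f i differentiable (at x)"
  and int_f: "integrable P (\<lambda>i. f i x)"
  and int_grad: "integrable P (\<lambda>i. gradient (f i) x)"
  and grad_F: "F' x = (\<integral>i. gradient (f i) x \<partial>P)"
  and bdd: "bdd_below (range F)"
  and lip: "i \<in> space P \<Longrightarrow> norm (gradient (f i) x - gradient (f i) y) \<le> L * norm (x - y)"
  using smooth by (auto simp: smooth_problem_def)

lemma taylor: "i \<in> space P \<Longrightarrow> \<bar>f i y - f i x - gradient (f i) x \<bullet> (y - x)\<bar> \<le> L / 2 * (norm (y - x))\<^sup>2"
  by (rule smooth_quadratic) (auto intro: diff lip)

text \<open>
  The Lipschitz bound and the quadratic bound pass from the \<open>f i\<close> to the objective by integration,
  since its gradient is the mean of the gradients.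
\<close>

lemma F'_lipschitz: "norm (F' x - F' y) \<le> L * norm (x - y)"
proof -
  have "norm (F' x - F' y) = norm (\<integral>i. gradient (f i) x - gradient (f i) y \<partial>P)"
    by (simp add: grad_F int_grad)
  also have "\<dots> \<le> (\<integral>i. L * norm (x - y) \<partial>P)"
    by (rule norm_integral_le) (auto intro: int_grad lip)
  finally show ?thesis by (simp add: P.prob_space)
qed

lemma F_quadratic_upper: "F y \<le> F x + F' x \<bullet> (y - x) + L / 2 * (norm (y - x))\<^sup>2"
proof -
  have "F y - F x - F' x \<bullet> (y - x) = (\<integral>i. f i y - f i x - gradient (f i) x \<bullet> (y - x) \<partial>P)"
    by (simp add: grad_F objective_def int_grad int_f)
  also have "\<dots> \<le> (\<integral>i. L / 2 * (norm (y - x))\<^sup>2 \<partial>P)"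
  proof (rule integral_mono)
    show "f i y - f i x - gradient (f i) x \<bullet> (y - x) \<le> L / 2 * (norm (y - x))\<^sup>2" if "i \<in> space P" for i
      using taylor[OF that, of y x] by linarith
  qed (simp_all add: int_grad int_f)
  finally show ?thesis by (simp add: P.prob_space)
qed

lemma F'_measurable [measurable]: "F' \<in> borel_measurable borel"
proof -
  have "continuous_on UNIV F'"
  proof (rule lipschitz_on_continuous_on)
    show "L-lipschitz_on UNIV F'"
      using F'_lipschitz L_pos by (auto simp: lipschitz_on_def dist_norm)
  qed
  then show ?thesis by (rule borel_measurable_continuous_onI)
qed

lemma f_joint [measurable]: "(\<lambda>(i, x). f i x) \<in> borel_measurable (P \<Otimes>\<^sub>M borel)"
proof (rule borel_measurable_caratheodory)
  show "(\<lambda>i. f i x) \<in> borel_measurable P" for x using int_f by auto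
  show "continuous_on UNIV (f i)" if "i \<in> space P" for i
    by (auto intro!: differentiable_imp_continuous_on differentiable_at_imp_differentiable_on diff that)
qed

lemma f_comp_measurable [measurable (raw)]:
  "g \<in> N \<rightarrow>\<^sub>M P \<Longrightarrow> h \<in> borel_measurable N \<Longrightarrow> (\<lambda>x. f (g x) (h x)) \<in> borel_measurable N"
  using measurable_compose[OF measurable_Pair f_joint] by simp

abbreviation "sample_law \<equiv> \<Pi>\<^sub>M z\<in>(UNIV :: (nat \<times> nat) set). M"

lemma sample_measurable [measurable]:
  "(\<lambda>w. w z) \<in> sample_law \<rightarrow>\<^sub>M M" "(\<lambda>w. fst (w z)) \<in> sample_law \<rightarrow>\<^sub>M P"
proof -
  show *: "(\<lambda>w. w z) \<in> sample_law \<rightarrow>\<^sub>M M" by (rule measurable_component_singleton) simp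
  show "(\<lambda>w. fst (w z)) \<in> sample_law \<rightarrow>\<^sub>M P" by (rule measurable_compose[OF * measurable_fst])
qed

lemma gauss_quotient_measurable [measurable (raw)]:
  assumes "g \<in> borel_measurable N" and "h \<in> N \<rightarrow>\<^sub>M M"
  shows "(\<lambda>x. gauss_quotient \<mu> f (g x) (h x)) \<in> borel_measurable N"
proof -
  have [measurable]: "(\<lambda>x. fst (h x)) \<in> N \<rightarrow>\<^sub>M P" "(\<lambda>x. snd (h x)) \<in> borel_measurable N"
    using measurable_compose[OF assms(2) measurable_fst] measurable_compose[OF assms(2) measurable_snd]
    by (simp_all cong: measurable_cong_sets)
  have [measurable]: "g \<in> borel_measurable N" by fact
  show ?thesis unfolding gauss_quotient_def by measurable
qed

lemma gauss_quotient_linearization: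
  assumes "i \<in> space P" "0 < \<mu>"
  shows "norm (gauss_quotient \<mu> f x (i, u) - (gradient (f i) x \<bullet> u) *\<^sub>R u) \<le> L * \<mu> / 2 * norm u ^ 3"
proof -
  have "\<bar>(f i (x + \<mu> *\<^sub>R u) - f i x) / \<mu> - gradient (f i) x \<bullet> u\<bar> \<le> L * \<mu> / 2 * (norm u)\<^sup>2"
  proof -
    have "\<bar>f i (x + \<mu> *\<^sub>R u) - f i x - \<mu> * (gradient (f i) x \<bullet> u)\<bar> \<le> L / 2 * (\<mu> * norm u)\<^sup>2"
      using taylor[OF assms(1), of "x + \<mu> *\<^sub>R u" x] by (simp add: power_mult_distrib)
    then have "\<bar>f i (x + \<mu> *\<^sub>R u) - f i x - \<mu> * (gradient (f i) x \<bullet> u)\<bar> / \<mu> \<le> L / 2 * (\<mu> * norm u)\<^sup>2 / \<mu>"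
      using assms(2) by (intro divide_right_mono) auto
    moreover have "(f i (x + \<mu> *\<^sub>R u) - f i x) / \<mu> - gradient (f i) x \<bullet> u
        = (f i (x + \<mu> *\<^sub>R u) - f i x - \<mu> * (gradient (f i) x \<bullet> u)) / \<mu>"
      using assms(2) by (simp add: diff_divide_distrib)
    ultimately show ?thesis using assms(2)
      by (simp add: power2_eq_square mult_ac)
  qed
  then have "\<bar>(f i (x + \<mu> *\<^sub>R u) - f i x) / \<mu> - gradient (f i) x \<bullet> u\<bar> * norm u \<le> (L * \<mu> / 2 * (norm u)\<^sup>2) * norm u"
    by (rule mult_right_mono) simp
  then show ?thesis
    by (simp add: gauss_quotient_def power2_eq_square power3_eq_cube mult.assoc flip: scaleR_diff_left)
qed

lemma integral_direction:
  assumes "integrable \<gamma> (h :: real^'d \<Rightarrow> real)"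
  shows "integrable M (\<lambda>p. h (snd p))" and "(\<integral>p. h (snd p) \<partial>M) = (\<integral>u. h u \<partial>\<gamma>)"
proof -
  have [measurable]: "h \<in> borel_measurable \<gamma>" using assms by auto
  show I: "integrable M (\<lambda>p. h (snd p))"
    by (rule M.Fubini_integrable) (use assms in auto)
  show "(\<integral>p. h (snd p) \<partial>M) = (\<integral>u. h u \<partial>\<gamma>)"
    using M.integral_fst'[OF I] by (simp add: P.prob_space)
qed

lemma integral_linear_part:
  shows "integrable M (\<lambda>p. (gradient (f (fst p)) x \<bullet> snd p) *\<^sub>R snd p)" (is "integrable M ?h")
    and "(\<integral>p. (gradient (f (fst p)) x \<bullet> snd p) *\<^sub>R snd p \<partial>M) = F' x"
proof -
  have g [measurable]: "(\<lambda>i. gradient (f i) x) \<in> borel_measurable P" using int_grad by auto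
  have b: "integrable M (\<lambda>p. norm (gradient (f (fst p)) x) * (norm (snd p))\<^sup>2)"
    by (rule M.Fubini_integrable)
      (use gaussian_norm_moment2[OF refl, where 'd='d] int_grad[of x] in \<open>auto simp: abs_mult\<close>)
  show I: "integrable M ?h"
  proof (rule Bochner_Integration.integrable_bound[OF b])
    have "norm (?h p) \<le> norm (norm (gradient (f (fst p)) x) * (norm (snd p))\<^sup>2)" for p
      by (auto simp: power2_eq_square abs_mult mult.assoc[symmetric]
          intro!: mult_right_mono Cauchy_Schwarz_ineq2)
    then show "AE p in M. norm (?h p) \<le> norm (norm (gradient (f (fst p)) x) * (norm (snd p))\<^sup>2)"
      by (intro always_eventually allI)
    have [measurable]: "snd \<in> borel_measurable M"
      using measurable_snd[of P \<gamma>] by (simp cong: measurable_cong_sets)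
    have [measurable]: "(\<lambda>p. gradient (f (fst p)) x) \<in> borel_measurable M"
      by (rule measurable_compose[OF measurable_fst g])
    show "?h \<in> borel_measurable M" by measurable
  qed
  show "(\<integral>p. ?h p \<partial>M) = F' x"
    using M.integral_fst'[OF I] by (simp add: gaussian_inner_direction[OF refl] grad_F)
qed

lemma gauss_quotient_integrable:
  assumes "0 < \<mu>"
  shows "integrable M (gauss_quotient \<mu> f x)"
proof -
  let ?h = "\<lambda>p. (gradient (f (fst p)) x \<bullet> snd p) *\<^sub>R snd p"
  have "integrable M (\<lambda>p. gauss_quotient \<mu> f x p - ?h p)"
  proof (rule Bochner_Integration.integrable_bound)
    show "integrable M (\<lambda>p. L * \<mu> / 2 * norm (snd p) ^ 3)"
      using integral_direction(1)[OF gaussian_norm_moment3(1)[OF refl]] by simp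
    show "AE p in M. norm (gauss_quotient \<mu> f x p - ?h p) \<le> norm (L * \<mu> / 2 * norm (snd p) ^ 3)"
    proof (rule AE_I2)
      fix p assume "p \<in> space M"
      then have "norm (gauss_quotient \<mu> f x p - ?h p) \<le> L * \<mu> / 2 * norm (snd p) ^ 3"
        using gauss_quotient_linearization[OF _ assms, of "fst p" x "snd p"]
        by (auto simp: space_pair_measure)
      then show "norm (gauss_quotient \<mu> f x p - ?h p) \<le> norm (L * \<mu> / 2 * norm (snd p) ^ 3)"
        unfolding real_norm_def by (rule order_trans[OF _ abs_ge_self])
    qed
  qed (use integral_linear_part(1) in measurable)
  from Bochner_Integration.integrable_add[OF this integral_linear_part(1)[of x]] show ?thesis by simp
qed

text \<open>
  The gradient at \<open>x\<close> of the Gaussian smoothing of \<open>F\<close>, that is, of the mean of \<open>F (x + \<mu> u)\<close> over \<open>u\<close>.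
\<close>

definition smoothed :: "real \<Rightarrow> real^'d \<Rightarrow> real^'d" where
  "smoothed \<mu> x = (\<integral>p. gauss_quotient \<mu> f x p \<partial>M)"

lemma smoothed_measurable [measurable]: "smoothed \<mu> \<in> borel_measurable borel"
  unfolding smoothed_def by measurable

lemma smoothed_bias:
  assumes "0 < \<mu>"
  shows "(norm (smoothed \<mu> x - F' x))\<^sup>2 \<le> 3 / 4 * (L * \<mu>)\<^sup>2 * real CARD('d) ^ 3"
proof -
  let ?h = "\<lambda>p. (gradient (f (fst p)) x \<bullet> snd p) *\<^sub>R snd p"
  have "norm (smoothed \<mu> x - F' x) = norm (\<integral>p. gauss_quotient \<mu> f x p - ?h p \<partial>M)"
    by (simp add: smoothed_def integral_linear_part gauss_quotient_integrable[OF assms])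
  also have "\<dots> \<le> (\<integral>p. L * \<mu> / 2 * norm (snd p) ^ 3 \<partial>M)"
  proof (rule norm_integral_le)
    show "integrable M (\<lambda>p. L * \<mu> / 2 * norm (snd p) ^ 3)"
      using integral_direction(1)[OF gaussian_norm_moment3(1)[OF refl]] by simp
  qed (use gauss_quotient_linearization[OF _ assms] in
      \<open>auto simp: space_pair_measure integral_linear_part gauss_quotient_integrable[OF assms]\<close>)
  also have "\<dots> = L * \<mu> / 2 * (\<integral>u. norm u ^ 3 \<partial>\<gamma>)"
    using integral_direction[OF gaussian_norm_moment3(1)[OF refl]] by simp
  finally have "(norm (smoothed \<mu> x - F' x))\<^sup>2 \<le> (L * \<mu> / 2 * (\<integral>u. norm u ^ 3 \<partial>\<gamma>))\<^sup>2"
    by (rule power_mono) simp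
  also have "\<dots> = (L * \<mu>)\<^sup>2 / 4 * (\<integral>u. norm u ^ 3 \<partial>\<gamma>)\<^sup>2" by (simp add: power_mult_distrib power_divide)
  also have "\<dots> \<le> (L * \<mu>)\<^sup>2 / 4 * (3 * real CARD('d) ^ 3)"
    by (intro mult_left_mono gaussian_norm_moment3(2)[OF refl]) simp
  finally show ?thesis by simp
qed

text \<open>
  The quotients at \<open>x\<close> and \<open>y\<close> share \<open>i\<close> and \<open>u\<close>, so their linear parts combine to \<open>(a \<bullet> u) u\<close> with \<open>a\<close>
  the difference of the gradients, and \<open>gaussian_inner_norm_sq\<close> applies. The remainders are of order
  \<open>\<mu> |u|\<^sup>3\<close> each.
\<close>

lemma gauss_quotient_diff_sq:
  assumes "0 < \<mu>"
  shows "(\<integral>\<^sup>+p. ennreal ((norm (gauss_quotient \<mu> f x p - gauss_quotient \<mu> f y p))\<^sup>2) \<partial>M)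
    \<le> ennreal (6 * real CARD('d) * (L * norm (x - y))\<^sup>2 + 30 * (L * \<mu>)\<^sup>2 * real CARD('d) ^ 3)"
proof -
  let ?D = "\<lambda>p. gauss_quotient \<mu> f x p - gauss_quotient \<mu> f y p"
  have inner: "(\<integral>\<^sup>+u. ennreal ((norm (?D (i, u)))\<^sup>2) \<partial>\<gamma>)
      \<le> ennreal (6 * real CARD('d) * (L * norm (x - y))\<^sup>2 + 30 * (L * \<mu>)\<^sup>2 * real CARD('d) ^ 3)" if i: "i \<in> space P" for i
  proof -
    define a where "a = gradient (f i) x - gradient (f i) y"
    have b: "(norm (?D (i, u)))\<^sup>2 \<le> 2 * ((a \<bullet> u)\<^sup>2 * (norm u)\<^sup>2) + 2 * (L * \<mu>)\<^sup>2 * norm u ^ 6" for u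
    proof -
      define R where "R x = gauss_quotient \<mu> f x (i, u) - (gradient (f i) x \<bullet> u) *\<^sub>R u" for x
      have "norm (R x - R y) \<le> L * \<mu> / 2 * norm u ^ 3 + L * \<mu> / 2 * norm u ^ 3"
        unfolding R_def
        by (intro order_trans[OF norm_triangle_ineq4] add_mono gauss_quotient_linearization i assms)
      then have "norm (R x - R y) \<le> L * \<mu> * norm u ^ 3" by simp
      then have R: "(norm (R x - R y))\<^sup>2 \<le> (L * \<mu> * norm u ^ 3)\<^sup>2" by (rule power_mono) simp
      have "?D (i, u) = (a \<bullet> u) *\<^sub>R u + (R x - R y)"
        by (simp add: R_def a_def inner_diff_left scaleR_diff_left)
      then have "(norm (?D (i, u)))\<^sup>2 \<le> 2 * (norm ((a \<bullet> u) *\<^sub>R u))\<^sup>2 + 2 * (norm (R x - R y))\<^sup>2"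
        by (simp only: norm_add_sq_le)
      also have "\<dots> \<le> 2 * (norm ((a \<bullet> u) *\<^sub>R u))\<^sup>2 + 2 * (L * \<mu> * norm u ^ 3)\<^sup>2" using R by simp
      finally show ?thesis by (simp add: power_mult_distrib mult_ac flip: power_mult)
    qed
    have "(\<integral>\<^sup>+u. ennreal ((norm (?D (i, u)))\<^sup>2) \<partial>\<gamma>)
      \<le> (\<integral>\<^sup>+u. 2 * ennreal ((a \<bullet> u)\<^sup>2 * (norm u)\<^sup>2) + ennreal (2 * (L * \<mu>)\<^sup>2) * ennreal (norm u ^ 6) \<partial>\<gamma>)"
      using b by (intro nn_integral_mono)
        (simp add: ennreal_mult[symmetric] ennreal_plus[symmetric] ennreal_leI
          flip: ennreal_numeral del: ennreal_plus)
    also have "\<dots> = 2 * (\<integral>\<^sup>+u. ennreal ((a \<bullet> u)\<^sup>2 * (norm u)\<^sup>2) \<partial>\<gamma>)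
        + ennreal (2 * (L * \<mu>)\<^sup>2) * (\<integral>\<^sup>+u. ennreal (norm u ^ 6) \<partial>\<gamma>)"
    proof -
      have "borel_measurable \<gamma> = (borel_measurable borel :: (real^'d \<Rightarrow> ennreal) set)"
        by (rule measurable_cong_sets) simp_all
      then show ?thesis by (simp add: nn_integral_add nn_integral_cmult)
    qed
    also have "(\<integral>\<^sup>+u. ennreal (norm u ^ 6) \<partial>\<gamma>) = ennreal (\<integral>u. norm u ^ 6 \<partial>\<gamma>)"
      by (rule nn_integral_eq_integral[OF gaussian_norm_moment6(1)[OF refl]]) simp
    also have "2 * (\<integral>\<^sup>+u. ennreal ((a \<bullet> u)\<^sup>2 * (norm u)\<^sup>2) \<partial>\<gamma>)
        + ennreal (2 * (L * \<mu>)\<^sup>2) * ennreal (\<integral>u. norm u ^ 6 \<partial>\<gamma>)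
      \<le> 2 * ennreal (3 * real CARD('d) * (norm a)\<^sup>2) + ennreal (2 * (L * \<mu>)\<^sup>2) * ennreal (15 * real CARD('d) ^ 3)"
      by (intro add_mono mult_left_mono ennreal_leI gaussian_inner_norm_sq gaussian_norm_moment6(2) refl) auto
    also have "\<dots> = ennreal (6 * real CARD('d) * (norm a)\<^sup>2 + 30 * (L * \<mu>)\<^sup>2 * real CARD('d) ^ 3)"
      by (simp add: ennreal_mult[symmetric] ennreal_plus[symmetric] mult_ac
          flip: ennreal_numeral del: ennreal_plus)
    also have "\<dots> \<le> ennreal (6 * real CARD('d) * (L * norm (x - y))\<^sup>2 + 30 * (L * \<mu>)\<^sup>2 * real CARD('d) ^ 3)"
      unfolding a_def by (intro ennreal_leI add_right_mono mult_left_mono power_mono lip i) auto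
    finally show ?thesis .
  qed
  have "(\<integral>\<^sup>+p. ennreal ((norm (?D p))\<^sup>2) \<partial>M) = (\<integral>\<^sup>+i. (\<integral>\<^sup>+u. ennreal ((norm (?D (i, u)))\<^sup>2) \<partial>\<gamma>) \<partial>P)"
    by (rule \<gamma>.nn_integral_fst[symmetric]) measurable
  also have "\<dots> \<le> (\<integral>\<^sup>+i. ennreal (6 * real CARD('d) * (L * norm (x - y))\<^sup>2 + 30 * (L * \<mu>)\<^sup>2 * real CARD('d) ^ 3) \<partial>P)"
    by (rule nn_integral_mono) (rule inner)
  finally show ?thesis by (simp add: P.emeasure_space_1)
qed

end
section \<open>The error of the estimates along a run\<close>

lemma gauss_diff_pair_batch:
  "gauss_diff \<mu> f (pair_batch s w k) x y
    = (\<Sum>t<s. (1 / real s) *\<^sub>R (gauss_quotient \<mu> f x (w (k, t)) - gauss_quotient \<mu> f y (w (k, t))))"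
  by (simp add: gauss_diff_def pair_batch_def gauss_quotient_def image_mset.compositionality
      comp_def case_prod_beta flip: sum_unfold_sum_mset scaleR_sum_right)

text \<open>
  A run with an arbitrary rule \<open>B\<close> for the reset batches, which are samples in the on-line setting and
  all indices in the finite-sum setting. A reset is required to have mean square error \<open>\<epsilon>\<^sup>2 / 24\<close> at
  every point \<open>Y\<close> that does not depend on the samples of its own iteration. The assumption \<open>period\<close>
  balances the number \<open>q - 1\<close> of corrections between two resets against the size \<open>s\<close> of a batch.
\<close>

locale spider_run = stochastic_objective P f L
  for P :: "'i measure" and f :: "'i \<Rightarrow> real^'d \<Rightarrow> real" and L :: real +
  fixes \<epsilon> n0 \<mu> :: real and x0 :: "real^'d" and q s :: nat
    and B :: "(nat \<times> nat \<Rightarrow> 'i \<times> (real^'d)) \<Rightarrow> nat \<Rightarrow> 'i multiset"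
  assumes eps: "0 < \<epsilon>" and n0: "1 \<le> n0" and q: "0 < q" and s: "0 < s"
    and mu: "0 < \<mu>" "6 * (L * \<mu>)\<^sup>2 * n0\<^sup>2 * real CARD('d) ^ 3 \<le> \<epsilon>\<^sup>2"
    and period: "6 * real (q - 1) * (2 * real CARD('d) + 9) \<le> n0\<^sup>2 * real s"
    and B_adapted: "\<And>w k k' t p. k < k' \<Longrightarrow> B (w((k', t) := p)) k = B w k"
    and reset_measurable: "\<And>k Y. Y \<in> borel_measurable sample_law \<Longrightarrow>
      (\<lambda>w. coord_est \<mu> f (B w k) (Y w)) \<in> borel_measurable sample_law"
    and reset_error: "\<And>k Y. Y \<in> borel_measurable sample_law \<Longrightarrow> (\<And>w t p. Y (w((k, t) := p)) = Y w) \<Longrightarrow>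
      (\<integral>\<^sup>+w. ennreal ((norm (coord_est \<mu> f (B w k) (Y w) - F' (Y w)))\<^sup>2) \<partial>sample_law) \<le> ennreal (\<epsilon>\<^sup>2 / 24)"
begin

abbreviation "\<Omega> \<equiv> sample_law"
abbreviation \<eta> :: "real^'d \<Rightarrow> real" where "\<eta> \<equiv> szo_eta L n0 \<epsilon>"

sublocale \<Omega>: prob_space \<Omega> by (intro prob_space_PiM) (rule M.prob_space_axioms)

definition X :: "(nat \<times> nat \<Rightarrow> 'i \<times> (real^'d)) \<Rightarrow> nat \<Rightarrow> real^'d" where
  "X w k = fst (spider_szo f \<mu> \<eta> q (B w) (pair_batch s w) x0 k)"

definition V :: "(nat \<times> nat \<Rightarrow> 'i \<times> (real^'d)) \<Rightarrow> nat \<Rightarrow> real^'d" where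
  "V w k = snd (spider_szo f \<mu> \<eta> q (B w) (pair_batch s w) x0 k)"

lemma X_0: "X w 0 = x0"
  by (simp add: X_def)

lemma X_Suc: "X w (Suc k) = X w k - \<eta> (V w k) *\<^sub>R V w k"
  by (simp add: X_def V_def case_prod_beta Let_def)

lemma V_reset: "q dvd k \<Longrightarrow> V w k = coord_est \<mu> f (B w k) (X w k)"
  by (cases k) (simp_all add: X_def V_def case_prod_beta Let_def)

lemma V_step:
  "\<not> q dvd Suc k \<Longrightarrow> V w (Suc k) = V w k +
    (\<Sum>t<s. (1 / real s) *\<^sub>R
      (gauss_quotient \<mu> f (X w (Suc k)) (w (Suc k, t)) - gauss_quotient \<mu> f (X w k) (w (Suc k, t))))"
  by (simp add: X_def V_def case_prod_beta Let_def gauss_diff_pair_batch)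

text \<open>
  Iterate and estimate up to step \<open>k\<close> are determined by the samples drawn up to step \<open>k\<close>.
\<close>

lemma state_cong:
  assumes "\<And>j. j < k' \<Longrightarrow> B w' j = B w j" and "\<And>j t. j < k' \<Longrightarrow> w' (j, t) = w (j, t)"
  shows "k < k' \<Longrightarrow> X w' k = X w k \<and> V w' k = V w k"
proof (induction k)
  case 0
  then show ?case by (simp add: X_0 V_reset assms)
next
  case (Suc k)
  then show ?case by (cases "q dvd Suc k") (auto simp: X_Suc V_reset V_step assms)
qed

lemma state_adapted: "k < k' \<Longrightarrow> X (w((k', t) := p)) k = X w k \<and> V (w((k', t) := p)) k = V w k"
  by (rule state_cong[of k']) (auto intro: B_adapted)

lemma X_adapted: "X (w((k, t) := p)) k = X w k"
  by (cases k) (simp_all add: X_0 X_Suc state_adapted)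

lemma eta_measurable [measurable]: "\<eta> \<in> borel_measurable borel"
  unfolding szo_eta_def[abs_def] by measurable

lemma state_measurable: "(\<lambda>w. X w k) \<in> borel_measurable \<Omega> \<and> (\<lambda>w. V w k) \<in> borel_measurable \<Omega>"
proof (induction k)
  case 0
  then show ?case by (auto simp: X_0 V_reset intro!: reset_measurable)
next
  case (Suc k)
  then have [measurable]: "(\<lambda>w. X w k) \<in> borel_measurable \<Omega>" "(\<lambda>w. V w k) \<in> borel_measurable \<Omega>"
    by auto
  have [measurable]: "(\<lambda>w. X w (Suc k)) \<in> borel_measurable \<Omega>"
    unfolding X_Suc by measurable
  show ?case
  proof (cases "q dvd Suc k")
    case True
    then show ?thesis by (auto simp: V_reset intro!: reset_measurable)
  next
    case False
    then show ?thesis by (simp add: V_step)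
  qed
qed

lemma X_measurable [measurable]: "(\<lambda>w. X w k) \<in> borel_measurable \<Omega>"
  and V_measurable [measurable]: "(\<lambda>w. V w k) \<in> borel_measurable \<Omega>"
  using state_measurable by auto

lemma step_length: "norm (X w (Suc k) - X w k) \<le> \<epsilon> / (L * n0)"
proof (cases "V w k = 0")
  case True
  then show ?thesis using eps n0 L_pos by (simp add: X_Suc)
next
  case False
  have "norm (X w (Suc k) - X w k) = \<eta> (V w k) * norm (V w k)"
    using eps n0 L_pos by (simp add: X_Suc szo_eta_def)
  also have "\<dots> \<le> \<epsilon> / (L * n0 * norm (V w k)) * norm (V w k)"
    by (intro mult_right_mono) (auto simp: szo_eta_def)
  also have "\<dots> = \<epsilon> / (L * n0)" using False by simp
  finally show ?thesis .
qed

text \<open>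
  A bound for the second moment of one difference of quotients at consecutive iterates; dividing
  by \<open>s\<close> gives the growth of the mean square error in one correction.
\<close>

definition drift :: real where
  "drift = 3 * (2 * real CARD('d) + 9) * \<epsilon>\<^sup>2 / n0\<^sup>2"

lemma drift_nonneg: "0 \<le> drift" by (simp add: drift_def)

lemma smoothed_bias_eps: "(norm (smoothed \<mu> x - F' x))\<^sup>2 \<le> \<epsilon>\<^sup>2 / 8"
proof -
  have "6 * (L * \<mu>)\<^sup>2 * real CARD('d) ^ 3 * 1 \<le> 6 * (L * \<mu>)\<^sup>2 * real CARD('d) ^ 3 * n0\<^sup>2"
    using n0 by (intro mult_left_mono) auto
  with mu(2) smoothed_bias[OF mu(1), of x] show ?thesis by (simp add: mult_ac)
qed

lemma quotient_diff_sq_le_drift: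
  assumes "norm (x - y) \<le> \<epsilon> / (L * n0)"
  shows "(\<integral>\<^sup>+p. ennreal ((norm (gauss_quotient \<mu> f x p - gauss_quotient \<mu> f y p))\<^sup>2) \<partial>M) \<le> ennreal drift"
proof (rule order_trans[OF gauss_quotient_diff_sq[OF mu(1)] ennreal_leI])
  have "L * norm (x - y) \<le> \<epsilon> / n0"
    using mult_left_mono[OF assms, of L] L_pos by simp
  then have "(L * norm (x - y))\<^sup>2 \<le> (\<epsilon> / n0)\<^sup>2" using L_pos by (intro power_mono) auto
  then have 1: "6 * real CARD('d) * (L * norm (x - y))\<^sup>2 \<le> 6 * real CARD('d) * (\<epsilon>\<^sup>2 / n0\<^sup>2)"
    by (intro mult_left_mono) (auto simp: power_divide)
  have 2: "30 * (L * \<mu>)\<^sup>2 * real CARD('d) ^ 3 \<le> 5 * (\<epsilon>\<^sup>2 / n0\<^sup>2)"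
    using mu(2) n0 by (simp add: field_simps)
  have "0 \<le> \<epsilon>\<^sup>2 / n0\<^sup>2" by simp
  moreover have "drift = 6 * real CARD('d) * (\<epsilon>\<^sup>2 / n0\<^sup>2) + 27 * (\<epsilon>\<^sup>2 / n0\<^sup>2)"
    by (simp add: drift_def algebra_simps add_divide_distrib)
  ultimately show "6 * real CARD('d) * (L * norm (x - y))\<^sup>2 + 30 * (L * \<mu>)\<^sup>2 * real CARD('d) ^ 3 \<le> drift"
    using 1 2 by linarith
qed

text \<open>
  The constant is \<open>2/24 + 2/8\<close>, for the reset and for the distance between \<open>smoothed\<close> and \<open>F'\<close>.
\<close>

lemma reset_error_smoothed:
  assumes "q dvd k"
  shows "(\<integral>\<^sup>+w. ennreal ((norm (V w k - smoothed \<mu> (X w k)))\<^sup>2) \<partial>\<Omega>) \<le> ennreal (\<epsilon>\<^sup>2 / 3)"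
proof -
  have "(\<integral>\<^sup>+w. ennreal ((norm (V w k - F' (X w k)))\<^sup>2) \<partial>\<Omega>) \<le> ennreal (\<epsilon>\<^sup>2 / 24)"
    unfolding V_reset[OF assms] by (rule reset_error) (auto simp: X_adapted)
  then have "(\<integral>\<^sup>+w. ennreal ((norm ((V w k - F' (X w k)) + (F' (X w k) - smoothed \<mu> (X w k))))\<^sup>2) \<partial>\<Omega>)
      \<le> ennreal (2 * (\<epsilon>\<^sup>2 / 24) + 2 * (\<epsilon>\<^sup>2 / 8))"
    using smoothed_bias_eps by (intro nn_integral_norm_add_sq_le \<Omega>.prob_space_axioms) (auto simp: norm_minus_commute)
  then show ?thesis by simp
qed

text \<open>
  Relative to \<open>smoothed\<close>, a correction is a sum of centred fresh terms \<open>Z\<close>, so the second moments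
  add. The residue \<open>k mod q\<close> counts the corrections since the last reset.
\<close>

lemma estimator_error_smoothed:
  "(\<integral>\<^sup>+w. ennreal ((norm (V w k - smoothed \<mu> (X w k)))\<^sup>2) \<partial>\<Omega>)
    \<le> ennreal (\<epsilon>\<^sup>2 / 3 + real (k mod q) * (drift / real s))"
proof (induction k)
  case 0
  show ?case using reset_error_smoothed[of 0] by simp
next
  case (Suc k)
  show ?case
  proof (cases "q dvd Suc k")
    case True
    then show ?thesis using reset_error_smoothed[OF True] by (simp add: dvd_eq_mod_eq_0)
  next
    case False
    define D where "D w p = gauss_quotient \<mu> f (X w (Suc k)) p - gauss_quotient \<mu> f (X w k) p" for w p
    define Z where "Z w p = (1 / real s) *\<^sub>R (D w p - (\<integral>p. D w p \<partial>M))" for w p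
    have D_int: "integrable M (D w)" for w
      unfolding D_def by (intro Bochner_Integration.integrable_diff gauss_quotient_integrable mu)
    have D_mean: "(\<integral>p. D w p \<partial>M) = smoothed \<mu> (X w (Suc k)) - smoothed \<mu> (X w k)" for w
      unfolding D_def smoothed_def by (intro Bochner_Integration.integral_diff gauss_quotient_integrable mu)
    have decomp: "V w (Suc k) - smoothed \<mu> (X w (Suc k))
        = (V w k - smoothed \<mu> (X w k)) + (\<Sum>t<s. Z w (w (Suc k, t)))" for w
      using s by (simp add: V_step[OF False] Z_def D_mean scaleR_diff_right sum_subtractf sum_constant_scaleR
          flip: D_def del: sum_constant)
    have "(\<integral>\<^sup>+w. ennreal ((norm ((V w k - smoothed \<mu> (X w k)) + (\<Sum>t<s. Z w (w (Suc k, t)))))\<^sup>2) \<partial>\<Omega>)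
      \<le> (\<integral>\<^sup>+w. ennreal ((norm (V w k - smoothed \<mu> (X w k)))\<^sup>2) \<partial>\<Omega>)
        + ennreal (real s * (drift / (real s)\<^sup>2))"
    proof (rule nn_integral_norm_sq_fresh_sum)
      show "prob_space M" by (rule M.prob_space_axioms)
      show "(\<lambda>w. V w k - smoothed \<mu> (X w k)) \<in> borel_measurable \<Omega>" by measurable
      have [measurable]: "(\<lambda>z. X (fst z) j) \<in> borel_measurable (\<Omega> \<Otimes>\<^sub>M M)" for j
        by (rule measurable_compose[OF measurable_fst X_measurable])
      show "(\<lambda>(w, p). Z w p) \<in> borel_measurable (\<Omega> \<Otimes>\<^sub>M M)"
        unfolding Z_def D_mean unfolding D_def case_prod_beta by measurable
      show "Z (w((Suc k, t) := p)) = Z w" for w t p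
        by (simp add: Z_def D_def X_adapted state_adapted fun_eq_iff)
      show "integrable M (Z w)" for w
        unfolding Z_def using D_int by simp
      show "(\<integral>p. Z w p \<partial>M) = 0" for w
        unfolding Z_def using D_int by (simp add: M.prob_space)
      show "(\<integral>\<^sup>+p. ennreal ((norm (Z w p))\<^sup>2) \<partial>M) \<le> ennreal (drift / (real s)\<^sup>2)" for w
      proof -
        have [measurable]: "D w \<in> borel_measurable M" using D_int by auto
        have "(\<integral>\<^sup>+p. ennreal ((norm (Z w p))\<^sup>2) \<partial>M)
            = (\<integral>\<^sup>+p. ennreal (1 / (real s)\<^sup>2) * ennreal ((norm (D w p - (\<integral>p. D w p \<partial>M)))\<^sup>2) \<partial>M)"
          by (simp add: Z_def power_mult_distrib power_divide flip: ennreal_mult)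
        also have "\<dots> = ennreal (1 / (real s)\<^sup>2) * (\<integral>\<^sup>+p. ennreal ((norm (D w p - (\<integral>p. D w p \<partial>M)))\<^sup>2) \<partial>M)"
          by (rule nn_integral_cmult) measurable
        also have "\<dots> \<le> ennreal (1 / (real s)\<^sup>2) * ennreal drift"
          using quotient_diff_sq_le_drift[OF step_length]
          by (intro mult_left_mono nn_integral_variance_le M.prob_space_axioms D_int drift_nonneg)
            (auto simp: D_def)
        finally show ?thesis using drift_nonneg by (simp add: ennreal_mult[symmetric])
      qed
    qed (auto simp: state_adapted drift_nonneg)
    also have "\<dots> \<le> ennreal (\<epsilon>\<^sup>2 / 3 + real (k mod q) * (drift / real s)) + ennreal (drift / real s)"
      using s by (intro add_mono Suc.IH) (simp add: power2_eq_square)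
    also have "\<dots> = ennreal (\<epsilon>\<^sup>2 / 3 + (real (k mod q) + 1) * (drift / real s))"
      using drift_nonneg by (subst ennreal_plus[symmetric]) (auto simp: distrib_right add_divide_distrib simp del: ennreal_plus)
    also have "real (k mod q) + 1 = real (Suc k mod q)"
      using False by (simp add: mod_Suc dvd_eq_mod_eq_0 split: if_splits)
    finally show ?thesis by (simp add: decomp)
  qed
qed

text \<open>
  The corrections contribute at most \<open>\<epsilon>\<^sup>2 / 2\<close>, which gives \<open>1/3 + 1/2 = 5/6\<close> relative to \<open>smoothed\<close>
  and \<open>2 * 5/6 + 2/8 = 23/12\<close> relative to \<open>F'\<close>.
\<close>

lemma estimator_error:
  "(\<integral>\<^sup>+w. ennreal ((norm (V w k - F' (X w k)))\<^sup>2) \<partial>\<Omega>) \<le> ennreal (23 / 12 * \<epsilon>\<^sup>2)"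
proof -
  have "k mod q \<le> q - 1" using q by (metis Suc_pred' less_Suc_eq_le mod_less_divisor)
  then have "real (k mod q) * (drift / real s) \<le> real (q - 1) * (drift / real s)"
    using drift_nonneg by (intro mult_right_mono) auto
  also have "\<dots> = (6 * real (q - 1) * (2 * real CARD('d) + 9)) * (\<epsilon>\<^sup>2 / (2 * n0\<^sup>2 * real s))"
    using s n0 by (simp add: drift_def field_simps)
  also have "\<dots> \<le> (n0\<^sup>2 * real s) * (\<epsilon>\<^sup>2 / (2 * n0\<^sup>2 * real s))"
    by (intro mult_right_mono period) auto
  also have "\<dots> = \<epsilon>\<^sup>2 / 2" using s n0 by simp
  finally have "(\<integral>\<^sup>+w. ennreal ((norm (V w k - smoothed \<mu> (X w k)))\<^sup>2) \<partial>\<Omega>) \<le> ennreal (5 / 6 * \<epsilon>\<^sup>2)"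
    by (intro order_trans[OF estimator_error_smoothed ennreal_leI]) linarith
  then have "(\<integral>\<^sup>+w. ennreal ((norm ((V w k - smoothed \<mu> (X w k)) + (smoothed \<mu> (X w k) - F' (X w k))))\<^sup>2) \<partial>\<Omega>)
      \<le> ennreal (2 * (5 / 6 * \<epsilon>\<^sup>2) + 2 * (\<epsilon>\<^sup>2 / 8))"
    by (intro nn_integral_norm_add_sq_le smoothed_bias_eps \<Omega>.prob_space_axioms) auto
  then show ?thesis by (simp add: field_simps)
qed

section \<open>Descent\<close>

text \<open>
  With \<open>\<eta> \<le> 1 / (2 L n0)\<close>, a step decreases \<open>F\<close> by \<open>\<eta> |v|\<^sup>2 / 4\<close> up to a multiple of the squared error.
  The truncation makes \<open>L n0 \<eta> |v|\<^sup>2\<close> the minimum of \<open>|v|\<^sup>2 / 2\<close> and \<open>\<epsilon> |v|\<close>, both of which are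
  at least \<open>\<epsilon> |v| - \<epsilon>\<^sup>2 / 2\<close>; so the decrease controls \<open>|v|\<close> itself.
\<close>

lemma descent:
  "\<epsilon> * norm (F' (X w k))
    \<le> 4 * L * n0 * (F (X w k) - F (X w (Suc k))) + \<epsilon>\<^sup>2 + 3 / 2 * (norm (V w k - F' (X w k)))\<^sup>2"
proof -
  define x v g where "x = X w k" and "v = V w k" and "g = F' x"
  define e where "e = \<eta> v"
  have Ln: "0 < L * n0" using L_pos n0 by simp
  have e0: "0 \<le> e" unfolding e_def szo_eta_def using Ln eps by simp
  have e1: "e * (2 * (L * n0)) \<le> 1"
  proof -
    have "e * (2 * (L * n0)) \<le> 1 / (2 * L * n0) * (2 * (L * n0))"
      using Ln by (intro mult_right_mono) (auto simp: e_def szo_eta_def)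
    then show ?thesis using L_pos n0 by simp
  qed
  have "F (X w (Suc k)) \<le> F x + g \<bullet> (- e *\<^sub>R v) + L / 2 * (norm (- e *\<^sub>R v))\<^sup>2"
    using F_quadratic_upper[of "x - e *\<^sub>R v" x] by (simp add: X_Suc x_def v_def g_def e_def)
  then have 1: "F (X w (Suc k)) \<le> F x - e * (g \<bullet> v) + L / 2 * e\<^sup>2 * (norm v)\<^sup>2"
    by (simp add: power_mult_distrib)
  have polar: "(norm v)\<^sup>2 - (norm (v - g))\<^sup>2 \<le> 2 * (g \<bullet> v)"
    using zero_le_power2[of "norm g"]
    by (simp add: power2_norm_eq_inner inner_diff_left inner_diff_right inner_commute)
  have "e * L \<le> 1 / 2"
  proof -
    have "e * L * 1 \<le> e * L * n0" using e0 L_pos n0 by (intro mult_left_mono) auto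
    then show ?thesis using e1 by (simp add: mult_ac)
  qed
  then have "e * L * (e * (norm v)\<^sup>2) \<le> 1 / 2 * (e * (norm v)\<^sup>2)"
    using e0 by (intro mult_right_mono) auto
  then have 2: "L / 2 * e\<^sup>2 * (norm v)\<^sup>2 \<le> e * (norm v)\<^sup>2 / 4"
    by (simp add: power2_eq_square mult_ac)
  have 3: "e * ((norm v)\<^sup>2 - (norm (v - g))\<^sup>2) \<le> e * (2 * (g \<bullet> v))"
    using polar e0 by (rule mult_left_mono)
  have 4: "F (X w (Suc k)) \<le> F x - e * (norm v)\<^sup>2 / 4 + e * (norm (v - g))\<^sup>2 / 2"
    using 1 2 3 by (simp add: right_diff_distrib)
  have 5: "\<epsilon> * norm v - \<epsilon>\<^sup>2 / 2 \<le> L * n0 * (e * (norm v)\<^sup>2)"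
  proof (cases "v = 0")
    case False
    have "L * n0 * (e * (norm v)\<^sup>2) = min (L * n0 * (norm v)\<^sup>2 * (1 / (2 * L * n0)))
        (L * n0 * (norm v)\<^sup>2 * (\<epsilon> / (L * n0 * norm v)))"
      using Ln by (simp add: e_def szo_eta_def min_mult_distrib_left mult_ac)
    also have "\<dots> = min ((norm v)\<^sup>2 / 2) (\<epsilon> * norm v)"
      using L_pos n0 False by (simp add: power2_eq_square mult.commute[of \<epsilon>])
    finally show ?thesis
      using sum_squares_bound[of \<epsilon> "norm v"] by simp
  qed (use eps in simp)
  have "4 * (L * n0) * F (X w (Suc k)) \<le> 4 * (L * n0) * (F x - e * (norm v)\<^sup>2 / 4 + e * (norm (v - g))\<^sup>2 / 2)"
    using 4 Ln by (intro mult_left_mono) auto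
  moreover have "e * (2 * (L * n0)) * (norm (v - g))\<^sup>2 \<le> 1 * (norm (v - g))\<^sup>2"
    using e1 by (intro mult_right_mono) auto
  ultimately have 6: "\<epsilon> * norm v \<le> 4 * (L * n0) * (F x - F (X w (Suc k))) + \<epsilon>\<^sup>2 / 2 + (norm (v - g))\<^sup>2"
    using 5 by (simp add: algebra_simps)
  have "norm g \<le> norm v + norm (v - g)"
    using norm_triangle_sub[of g v] by (simp add: norm_minus_commute)
  then have "\<epsilon> * norm g \<le> \<epsilon> * norm v + \<epsilon> * norm (v - g)"
    using eps by (simp flip: distrib_left)
  moreover have "\<epsilon> * norm (v - g) \<le> \<epsilon>\<^sup>2 / 2 + (norm (v - g))\<^sup>2 / 2"
    using sum_squares_bound[of \<epsilon> "norm (v - g)"] by simp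
  ultimately show ?thesis using 6 by (simp add: x_def v_def g_def mult.assoc)
qed

lemma sum_gradient_norms:
  "\<epsilon> * (\<Sum>k<K. norm (F' (X w k)))
    \<le> 4 * L * n0 * initial_gap P f x0 + real K * \<epsilon>\<^sup>2 + 3 / 2 * (\<Sum>k<K. (norm (V w k - F' (X w k)))\<^sup>2)"
proof -
  have "(\<Sum>k<K. \<epsilon> * norm (F' (X w k)))
      \<le> (\<Sum>k<K. 4 * L * n0 * (F (X w k) - F (X w (Suc k))) + \<epsilon>\<^sup>2 + 3 / 2 * (norm (V w k - F' (X w k)))\<^sup>2)"
    by (intro sum_mono descent)
  also have "\<dots> = 4 * L * n0 * (F x0 - F (X w K)) + real K * \<epsilon>\<^sup>2
      + 3 / 2 * (\<Sum>k<K. (norm (V w k - F' (X w k)))\<^sup>2)"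
    using sum_lessThan_telescope'[of "\<lambda>k. F (X w k)" K]
    by (simp only: sum.distrib X_0 sum_distrib_left[symmetric]) simp
  also have "4 * L * n0 * (F x0 - F (X w K)) \<le> 4 * L * n0 * initial_gap P f x0"
    using L_pos n0 cINF_lower[OF bdd UNIV_I, of "X w K"]
    unfolding initial_gap_def by (intro mult_left_mono) auto
  finally show ?thesis by (simp add: sum_distrib_left)
qed

text \<open>
  The initial gap and the additive term of \<open>descent\<close> contribute \<open>K \<epsilon>\<close> each, the squared errors
  \<open>3/2 * 23/12 * K \<epsilon>\<close>, together \<open>39/8 * K \<epsilon>\<close>.
\<close>

lemma expected_sum_gradient_norms:
  assumes K: "4 * L * initial_gap P f x0 * n0 \<le> real K * \<epsilon>\<^sup>2"
  shows "(\<integral>\<^sup>+w. ennreal (\<Sum>k<K. norm (F' (X w k))) \<partial>\<Omega>) \<le> ennreal (39 / 8 * real K * \<epsilon>)"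
proof -
  let ?N = "\<lambda>w k. (norm (V w k - F' (X w k)))\<^sup>2"
  have "(\<Sum>k<K. norm (F' (X w k))) \<le> 2 * real K * \<epsilon> + 3 / (2 * \<epsilon>) * (\<Sum>k<K. ?N w k)" for w
  proof -
    have "\<epsilon> * (\<Sum>k<K. norm (F' (X w k))) \<le> 2 * real K * \<epsilon>\<^sup>2 + 3 / 2 * (\<Sum>k<K. ?N w k)"
      using sum_gradient_norms[where K=K and w=w] K by (simp add: mult_ac)
    then have "\<epsilon> * (\<Sum>k<K. norm (F' (X w k))) / \<epsilon> \<le> (2 * real K * \<epsilon>\<^sup>2 + 3 / 2 * (\<Sum>k<K. ?N w k)) / \<epsilon>"
      using eps by (intro divide_right_mono) auto
    then show ?thesis using eps by (simp add: add_divide_distrib power2_eq_square)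
  qed
  then have "(\<integral>\<^sup>+w. ennreal (\<Sum>k<K. norm (F' (X w k))) \<partial>\<Omega>)
      \<le> (\<integral>\<^sup>+w. ennreal (2 * real K * \<epsilon>) + ennreal (3 / (2 * \<epsilon>)) * (\<Sum>k<K. ennreal (?N w k)) \<partial>\<Omega>)"
    using eps by (intro nn_integral_mono)
      (simp add: sum_nonneg ennreal_leI sum_ennreal ennreal_mult[symmetric] ennreal_plus[symmetric] del: ennreal_plus)
  also have "\<dots> = ennreal (2 * real K * \<epsilon>)
      + ennreal (3 / (2 * \<epsilon>)) * (\<Sum>k<K. \<integral>\<^sup>+w. ennreal (?N w k) \<partial>\<Omega>)"
    by (simp add: nn_integral_add nn_integral_cmult nn_integral_sum \<Omega>.emeasure_space_1 del: sum_ennreal)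
  also have "\<dots> \<le> ennreal (2 * real K * \<epsilon>) + ennreal (3 / (2 * \<epsilon>)) * (\<Sum>k<K. ennreal (23 / 12 * \<epsilon>\<^sup>2))"
    by (intro add_left_mono mult_left_mono sum_mono estimator_error) simp
  also have "\<dots> = ennreal (2 * real K * \<epsilon> + 3 / (2 * \<epsilon>) * (\<Sum>k<K. 23 / 12 * \<epsilon>\<^sup>2))"
    using eps by (subst sum_ennreal, simp, subst ennreal_mult[symmetric], simp, simp add: sum_nonneg,
        subst ennreal_plus[symmetric]) (auto intro!: mult_nonneg_nonneg sum_nonneg)
  also have "2 * real K * \<epsilon> + 3 / (2 * \<epsilon>) * (\<Sum>k<K. 23 / 12 * \<epsilon>\<^sup>2) = 39 / 8 * real K * \<epsilon>"
    using eps by (simp add: power2_eq_square field_simps)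
  finally show ?thesis .
qed

theorem expected_output_gradient:
  assumes "0 < K" and K: "4 * L * initial_gap P f x0 * n0 \<le> real K * \<epsilon>\<^sup>2"
  shows "integrable (szo_law P K) (\<lambda>(w, k). norm (F' (X w k)))"
    and "(\<integral>\<xi>. (\<lambda>(w, k). norm (F' (X w k))) \<xi> \<partial>szo_law P K) \<le> 6 * \<epsilon>"
proof -
  let ?U = "uniform_count_measure {..<K}"
  let ?G = "\<lambda>(w, k). norm (F' (X w k))"
  interpret U: prob_space ?U by (rule prob_space_uniform_count_measure) (use \<open>0 < K\<close> in auto)
  have law: "szo_law P K = \<Omega> \<Otimes>\<^sub>M ?U" by (simp add: szo_law_def)
  have meas [measurable]: "?G \<in> borel_measurable (\<Omega> \<Otimes>\<^sub>M ?U)"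
    unfolding case_prod_beta
  proof (rule measurable_compose_countable'[where I = "{..<K}"])
    show "snd \<in> \<Omega> \<Otimes>\<^sub>M ?U \<rightarrow>\<^sub>M count_space {..<K}"
      by (rule measurable_compose[OF measurable_snd])
        (auto simp: measurable_def space_uniform_count_measure sets_uniform_count_measure)
    show "(\<lambda>z. norm (F' (X (fst z) k))) \<in> borel_measurable (\<Omega> \<Otimes>\<^sub>M ?U)" for k
      by (rule measurable_compose[OF measurable_fst]) measurable
  qed simp
  have "(\<integral>\<^sup>+\<xi>. ennreal (?G \<xi>) \<partial>(\<Omega> \<Otimes>\<^sub>M ?U)) = (\<integral>\<^sup>+w. (\<integral>\<^sup>+k. ennreal (norm (F' (X w k))) \<partial>?U) \<partial>\<Omega>)"
    by (subst U.nn_integral_fst[symmetric]) auto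
  also have "\<dots> = (\<integral>\<^sup>+w. ennreal (1 / real K) * ennreal (\<Sum>k<K. norm (F' (X w k))) \<partial>\<Omega>)"
    using \<open>0 < K\<close> unfolding uniform_count_measure_def
    by (simp add: nn_integral_point_measure_finite sum_distrib_left[symmetric] sum_ennreal)
  also have "\<dots> = ennreal (1 / real K) * (\<integral>\<^sup>+w. ennreal (\<Sum>k<K. norm (F' (X w k))) \<partial>\<Omega>)"
    by (rule nn_integral_cmult) measurable
  also have "\<dots> \<le> ennreal (1 / real K) * ennreal (39 / 8 * real K * \<epsilon>)"
    by (intro mult_left_mono expected_sum_gradient_norms K) simp
  also have "\<dots> = ennreal (39 / 8 * \<epsilon>)"
    using eps \<open>0 < K\<close> by (simp flip: ennreal_mult)
  finally have le: "(\<integral>\<^sup>+\<xi>. ennreal (?G \<xi>) \<partial>(\<Omega> \<Otimes>\<^sub>M ?U)) \<le> ennreal (39 / 8 * \<epsilon>)" .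
  show I: "integrable (szo_law P K) ?G"
    unfolding law by (rule integrableI_nonneg) (use le in \<open>auto intro: le_less_trans\<close>)
  have "ennreal (\<integral>\<xi>. ?G \<xi> \<partial>(\<Omega> \<Otimes>\<^sub>M ?U)) \<le> ennreal (39 / 8 * \<epsilon>)"
  proof -
    have "ennreal (\<integral>\<xi>. ?G \<xi> \<partial>(\<Omega> \<Otimes>\<^sub>M ?U)) = (\<integral>\<^sup>+\<xi>. ennreal (?G \<xi>) \<partial>(\<Omega> \<Otimes>\<^sub>M ?U))"
      by (rule nn_integral_eq_integral[OF I[unfolded law], symmetric]) auto
    with le show ?thesis by (simp only:)
  qed
  then have "(\<integral>\<xi>. ?G \<xi> \<partial>(\<Omega> \<Otimes>\<^sub>M ?U)) \<le> 39 / 8 * \<epsilon>"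
    using eps by simp
  also have "\<dots> \<le> 6 * \<epsilon>" using eps by simp
  finally show "(\<integral>\<xi>. ?G \<xi> \<partial>szo_law P K) \<le> 6 * \<epsilon>" unfolding law .
qed

end
section \<open>The two settings\<close>

text \<open>
  The period is rounded up, but only \<open>q - 1\<close> corrections follow a reset, and \<open>q - 1\<close> is below the
  unrounded value.
\<close>

lemma real_nat_ceiling_minus_one_le: "0 < x \<Longrightarrow> real (nat \<lceil>x\<rceil> - 1) \<le> x"
  by linarith

text \<open>
  The bound with factor \<open>24\<close> controls the coordinate-wise quotients, the one with factor \<open>6\<close> the
  Gaussian ones.
\<close>

lemma szo_mu_bounds:
  assumes "0 < L" "0 < \<epsilon>" "1 \<le> n0" "1 \<le> d"
  shows "0 < szo_mu d L n0 \<epsilon>"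
    and "24 * (L * szo_mu d L n0 \<epsilon>)\<^sup>2 * real d \<le> \<epsilon>\<^sup>2"
    and "6 * (L * szo_mu d L n0 \<epsilon>)\<^sup>2 * n0\<^sup>2 * real d ^ 3 \<le> \<epsilon>\<^sup>2"
proof -
  define \<mu> where "\<mu> = szo_mu d L n0 \<epsilon>"
  show "0 < szo_mu d L n0 \<epsilon>" using assms by (simp add: szo_mu_def)
  then have \<mu>: "0 < \<mu>" by (simp add: \<mu>_def)
  have "\<mu> \<le> \<epsilon> / (2 * sqrt 6 * L * sqrt (real d))" by (simp add: \<mu>_def szo_mu_def)
  then have "\<mu> * (2 * sqrt 6 * L * sqrt (real d)) \<le> \<epsilon>"
    using assms by (simp add: pos_le_divide_eq)
  then have "(\<mu> * (2 * sqrt 6 * L * sqrt (real d)))\<^sup>2 \<le> \<epsilon>\<^sup>2"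
    using \<mu> assms by (intro power_mono) auto
  then show "24 * (L * szo_mu d L n0 \<epsilon>)\<^sup>2 * real d \<le> \<epsilon>\<^sup>2"
    by (simp add: power_mult_distrib mult_ac flip: \<mu>_def)
  have sq: "((real d + 6) powr (3 / 2))\<^sup>2 = (real d + 6) ^ 3"
    by (simp add: powr_power powr_numeral)
  have "\<mu> \<le> \<epsilon> / (sqrt 6 * n0 * L * (real d + 6) powr (3/2))" by (simp add: \<mu>_def szo_mu_def)
  then have "\<mu> * (sqrt 6 * n0 * L * (real d + 6) powr (3/2)) \<le> \<epsilon>"
    using assms by (simp add: pos_le_divide_eq)
  then have "(\<mu> * (sqrt 6 * n0 * L * (real d + 6) powr (3/2)))\<^sup>2 \<le> \<epsilon>\<^sup>2"
    using \<mu> assms by (intro power_mono) auto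
  then have "6 * (L * \<mu>)\<^sup>2 * n0\<^sup>2 * (real d + 6) ^ 3 \<le> \<epsilon>\<^sup>2"
    by (simp only: power_mult_distrib sq) (simp add: mult_ac)
  moreover have "6 * (L * \<mu>)\<^sup>2 * n0\<^sup>2 * real d ^ 3 \<le> 6 * (L * \<mu>)\<^sup>2 * n0\<^sup>2 * (real d + 6) ^ 3"
    by (intro mult_left_mono power_mono) auto
  ultimately show "6 * (L * szo_mu d L n0 \<epsilon>)\<^sup>2 * n0\<^sup>2 * real d ^ 3 \<le> \<epsilon>\<^sup>2"
    unfolding \<mu>_def by linarith
qed

lemma szo_K_ge:
  assumes "0 < \<epsilon>"
  shows "4 * L * \<Delta> * n0 \<le> real (szo_K L \<Delta> n0 \<epsilon>) * \<epsilon>\<^sup>2"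
proof -
  have "4 * L * \<Delta> * n0 / \<epsilon>\<^sup>2 \<le> real (szo_K L \<Delta> n0 \<epsilon>)" unfolding szo_K_def by linarith
  then show ?thesis using assms by (simp add: pos_divide_le_eq)
qed

definition coord_quotient :: "real \<Rightarrow> (real^'d \<Rightarrow> real) \<Rightarrow> real^'d \<Rightarrow> real^'d" where
  "coord_quotient \<mu> h x = (\<chi> j. (h (x + \<mu> *\<^sub>R axis j 1) - h x) / \<mu>)"

lemma coord_est_eq_average:
  "coord_est \<mu> f B x = (1 / real (size B)) *\<^sub>R (\<Sum>i\<in>#B. coord_quotient \<mu> (f i) x)"
proof -
  have "(\<Sum>i\<in>#B. coord_quotient \<mu> (f i) x) $ j = (\<Sum>i\<in>#B. (f i (x + \<mu> *\<^sub>R axis j 1) - f i x) / \<mu>)" for j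
    by (induction B) (simp_all add: coord_quotient_def)
  then show ?thesis by (simp add: coord_est_def vec_eq_iff)
qed

lemma index_batch_eq: "index_batch b w k = image_mset (\<lambda>t. fst (w (k, t))) (mset_set {..<b})"
  by (simp add: index_batch_def pair_batch_def image_mset.compositionality comp_def)

lemma norm_sum_mset_le:
  fixes h :: "'b \<Rightarrow> 'a::real_normed_vector"
  shows "(\<And>i. i \<in># B \<Longrightarrow> norm (h i) \<le> c) \<Longrightarrow> norm (\<Sum>i\<in>#B. h i) \<le> real (size B) * c"
proof (induction B)
  case (add i B)
  have "norm (h i + (\<Sum>i\<in>#B. h i)) \<le> c + real (size B) * c"
    using add by (intro norm_triangle_le add_mono) auto
  then show ?case by (simp add: distrib_right)
qed simp

context stochastic_objective
begin

lemma gradient_joint_measurable [measurable]: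
  "(\<lambda>(i, x). gradient (f i) x) \<in> borel_measurable (P \<Otimes>\<^sub>M borel)"
proof (rule borel_measurable_caratheodory)
  show "(\<lambda>i. gradient (f i) x) \<in> borel_measurable P" for x using int_grad by auto
  show "continuous_on UNIV (gradient (f i))" if "i \<in> space P" for i
  proof (rule lipschitz_on_continuous_on)
    show "L-lipschitz_on UNIV (gradient (f i))"
      using lip[OF that] L_pos by (auto simp: lipschitz_on_def dist_norm)
  qed
qed

text \<open>
  Each coordinate is a one-dimensional forward difference with error at most \<open>L * \<mu> / 2\<close>.
\<close>

lemma coord_quotient_error:
  assumes "i \<in> space P" "0 < \<mu>"
  shows "norm (coord_quotient \<mu> (f i) x - gradient (f i) x) \<le> L * \<mu> / 2 * sqrt (real CARD('d))"
proof -
  have "\<bar>(coord_quotient \<mu> (f i) x - gradient (f i) x) $ j\<bar> \<le> L * \<mu> / 2" for j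
  proof -
    have "\<bar>f i (x + \<mu> *\<^sub>R axis j 1) - f i x - \<mu> * gradient (f i) x $ j\<bar> \<le> L / 2 * \<mu>\<^sup>2"
      using taylor[OF assms(1), of "x + \<mu> *\<^sub>R axis j 1" x]
      by (simp add: norm_axis_1 power_mult_distrib inner_axis)
    then have "\<bar>f i (x + \<mu> *\<^sub>R axis j 1) - f i x - \<mu> * gradient (f i) x $ j\<bar> / \<mu> \<le> L / 2 * \<mu>\<^sup>2 / \<mu>"
      using assms(2) by (intro divide_right_mono) auto
    moreover have "(coord_quotient \<mu> (f i) x - gradient (f i) x) $ j
        = (f i (x + \<mu> *\<^sub>R axis j 1) - f i x - \<mu> * gradient (f i) x $ j) / \<mu>"
      using assms(2) by (simp add: coord_quotient_def diff_divide_distrib)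
    ultimately show ?thesis using assms(2) by (simp add: power2_eq_square)
  qed
  then have "(norm (coord_quotient \<mu> (f i) x - gradient (f i) x))\<^sup>2 \<le> (\<Sum>j\<in>(UNIV::'d set). (L * \<mu> / 2)\<^sup>2)"
    unfolding norm_vec_power2 by (intro sum_mono) (metis abs_ge_zero power2_abs power_mono)
  also have "\<dots> = (L * \<mu> / 2 * sqrt (real CARD('d)))\<^sup>2"
    by (simp add: power_mult_distrib power_divide)
  finally show ?thesis
    by (rule power2_le_imp_le) (use assms L_pos in simp)
qed

lemma coord_est_error:
  assumes "set_mset B \<subseteq> space P" "B \<noteq> {#}" "0 < \<mu>"
  shows "(norm (coord_est \<mu> f B x - (1 / real (size B)) *\<^sub>R (\<Sum>i\<in>#B. gradient (f i) x)))\<^sup>2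
    \<le> (L * \<mu>)\<^sup>2 * real CARD('d) / 4"
proof -
  let ?c = "L * \<mu> / 2 * sqrt (real CARD('d))"
  have "norm (\<Sum>i\<in>#B. coord_quotient \<mu> (f i) x - gradient (f i) x) \<le> real (size B) * ?c"
    using assms by (intro norm_sum_mset_le coord_quotient_error) auto
  moreover have "(\<Sum>i\<in>#B. coord_quotient \<mu> (f i) x - gradient (f i) x)
      = (\<Sum>i\<in>#B. coord_quotient \<mu> (f i) x) - (\<Sum>i\<in>#B. gradient (f i) x)"
    by (induction B) simp_all
  ultimately have "norm (coord_est \<mu> f B x - (1 / real (size B)) *\<^sub>R (\<Sum>i\<in>#B. gradient (f i) x)) \<le> ?c"
    using assms(2) by (simp add: coord_est_eq_average pos_divide_le_eq nonempty_has_size mult.commute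
        flip: scaleR_diff_right)
  then have "(norm (coord_est \<mu> f B x - (1 / real (size B)) *\<^sub>R (\<Sum>i\<in>#B. gradient (f i) x)))\<^sup>2 \<le> ?c\<^sup>2"
    by (rule power_mono) simp
  then show ?thesis by (simp add: power_mult_distrib power_divide)
qed

lemma coord_quotient_measurable:
  assumes [measurable]: "g \<in> N \<rightarrow>\<^sub>M P" "Y \<in> borel_measurable N"
  shows "(\<lambda>w. coord_quotient \<mu> (f (g w)) (Y w)) \<in> borel_measurable N"
  unfolding coord_quotient_def by measurable

text \<open>
  The error splits into the deviation of the averaged gradients from their mean, with second moment
  \<open>\<sigma>\<^sup>2 / b\<close> by independence, and the discretization error. Both mean squares are at most
  \<open>\<epsilon>\<^sup>2 / 96\<close>, and \<open>2/96 + 2/96 = 1/24\<close>.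
\<close>

lemma online_reset_error:
  assumes noise: "bounded_noise P f \<sigma>" and b: "0 < b" "96 * \<sigma>\<^sup>2 \<le> real b * \<epsilon>\<^sup>2"
    and mu: "0 < \<mu>" "24 * (L * \<mu>)\<^sup>2 * real CARD('d) \<le> \<epsilon>\<^sup>2"
    and Y [measurable]: "Y \<in> borel_measurable sample_law" and Y_old: "\<And>w t p. Y (w((k, t) := p)) = Y w"
  shows "(\<integral>\<^sup>+w. ennreal ((norm (coord_est \<mu> f (index_batch b w k) (Y w) - F' (Y w)))\<^sup>2) \<partial>sample_law)
    \<le> ennreal (\<epsilon>\<^sup>2 / 24)"
proof -
  define Z where "Z w p = (1 / real b) *\<^sub>R (gradient (f (fst p)) (Y w) - F' (Y w))" for w and p :: "'i \<times> (real^'d)"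
  define bias where "bias w = coord_est \<mu> f (index_batch b w k) (Y w)
      - (1 / real b) *\<^sub>R (\<Sum>i\<in>#index_batch b w k. gradient (f i) (Y w))" for w
  have split: "coord_est \<mu> f (index_batch b w k) (Y w) - F' (Y w) = (\<Sum>t<b. Z w (w (k, t))) + bias w" for w
  proof -
    have "(1 / real b) *\<^sub>R (\<Sum>i\<in>#index_batch b w k. gradient (f i) (Y w)) - F' (Y w) = (\<Sum>t<b. Z w (w (k, t)))"
      using b(1) by (simp add: index_batch_eq image_mset.compositionality comp_def Z_def
          scaleR_diff_right sum_subtractf scaleR_sum_right sum_constant_scaleR
          flip: sum_unfold_sum_mset del: sum_constant)
    then show ?thesis by (simp add: bias_def algebra_simps)
  qed
  have "prob_space sample_law" by (intro prob_space_PiM M.prob_space_axioms)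
  have Zm: "(\<lambda>(w, p). Z w p) \<in> borel_measurable (sample_law \<Otimes>\<^sub>M M)"
  proof -
    have [measurable]: "(\<lambda>z. Y (fst z)) \<in> borel_measurable (sample_law \<Otimes>\<^sub>M M)"
      by (rule measurable_compose[OF measurable_fst Y])
    have [measurable]: "(\<lambda>z. fst (snd z)) \<in> sample_law \<Otimes>\<^sub>M M \<rightarrow>\<^sub>M P"
      by (rule measurable_compose[OF measurable_snd measurable_fst])
    have [measurable]: "(\<lambda>z. gradient (f (fst (snd z))) (Y (fst z))) \<in> borel_measurable (sample_law \<Otimes>\<^sub>M M)"
      using measurable_compose[OF measurable_Pair gradient_joint_measurable,
          of "\<lambda>z. fst (snd z)" "sample_law \<Otimes>\<^sub>M M" "\<lambda>z. Y (fst z)"] by simp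
    show ?thesis unfolding Z_def case_prod_beta by measurable
  qed
  have c: "real b * (\<sigma>\<^sup>2 / (real b)\<^sup>2) \<le> \<epsilon>\<^sup>2 / 96"
    using b by (simp add: power2_eq_square field_simps)
  have fst_int: "integrable M (\<lambda>p. gradient (f (fst p)) x)"
    and fst_mean: "(\<integral>p. gradient (f (fst p)) x \<partial>M) = F' x" for x
  proof -
    have *: "distr M P fst = P" by (rule \<gamma>.distr_pair_fst)
    have "integrable (distr M P fst) (\<lambda>i. gradient (f i) x)" unfolding * by (rule int_grad)
    then show "integrable M (\<lambda>p. gradient (f (fst p)) x)" by (rule integrable_distr[rotated]) simp
    have "F' x = (\<integral>i. gradient (f i) x \<partial>distr M P fst)" unfolding * by (rule grad_F)
    also have "\<dots> = (\<integral>p. gradient (f (fst p)) x \<partial>M)"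
      by (rule integral_distr) (use int_grad in auto)
    finally show "(\<integral>p. gradient (f (fst p)) x \<partial>M) = F' x" ..
  qed
  have "(\<integral>\<^sup>+w. ennreal ((norm (0 + (\<Sum>t<b. Z w (w (k, t)))))\<^sup>2) \<partial>sample_law)
      \<le> (\<integral>\<^sup>+w. ennreal ((norm (0 :: real^'d))\<^sup>2) \<partial>sample_law) + ennreal (real b * (\<sigma>\<^sup>2 / (real b)\<^sup>2))"
  proof (rule nn_integral_norm_sq_fresh_sum)
    show "Z (w((k, t) := p)) = Z w" for w t p by (simp add: Z_def Y_old fun_eq_iff)
    show "integrable M (Z w)" for w unfolding Z_def using fst_int by simp
    show "(\<integral>p. Z w p \<partial>M) = 0" for w
      unfolding Z_def using fst_int fst_mean by (simp add: M.prob_space)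
    have "(norm (Z w p))\<^sup>2 \<le> \<sigma>\<^sup>2 / (real b)\<^sup>2" if "p \<in> space M" for w p
      using noise that by (auto simp: Z_def bounded_noise_def space_pair_measure power_divide
          intro!: divide_right_mono)
    then have "(\<integral>\<^sup>+p. ennreal ((norm (Z w p))\<^sup>2) \<partial>M) \<le> (\<integral>\<^sup>+p. ennreal (\<sigma>\<^sup>2 / (real b)\<^sup>2) \<partial>M)" for w
      by (intro nn_integral_mono ennreal_leI)
    then show "(\<integral>\<^sup>+p. ennreal ((norm (Z w p))\<^sup>2) \<partial>M) \<le> ennreal (\<sigma>\<^sup>2 / (real b)\<^sup>2)" for w
      by (simp add: M.emeasure_space_1)
  qed (use Zm in \<open>auto intro: M.prob_space_axioms\<close>)
  then have "(\<integral>\<^sup>+w. ennreal ((norm (\<Sum>t<b. Z w (w (k, t))))\<^sup>2) \<partial>sample_law) \<le> ennreal (\<epsilon>\<^sup>2 / 96)"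
    using ennreal_leI[OF c] by (simp add: order_trans)
  moreover have "(norm (bias w))\<^sup>2 \<le> \<epsilon>\<^sup>2 / 96" if "w \<in> space sample_law" for w
  proof -
    have "w z \<in> space M" for z using measurable_space[OF sample_measurable(1) that] .
    then have "set_mset (index_batch b w k) \<subseteq> space P"
      by (auto simp: index_batch_eq space_pair_measure mem_Times_iff)
    moreover have "index_batch b w k \<noteq> {#}" "size (index_batch b w k) = b"
      using b(1) by (auto simp: index_batch_eq mset_set_empty_iff)
    ultimately have "(norm (bias w))\<^sup>2 \<le> (L * \<mu>)\<^sup>2 * real CARD('d) / 4"
      using coord_est_error[of "index_batch b w k" \<mu> "Y w"] mu(1) by (simp add: bias_def)
    with mu(2) show ?thesis by simp
  qed
  moreover have "(\<lambda>w. \<Sum>t<b. Z w (w (k, t))) \<in> borel_measurable sample_law"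
    using measurable_compose[OF measurable_Pair[OF measurable_ident_sets[OF refl] sample_measurable(1)] Zm]
    by (auto intro!: borel_measurable_sum)
  ultimately have "(\<integral>\<^sup>+w. ennreal ((norm ((\<Sum>t<b. Z w (w (k, t))) + bias w))\<^sup>2) \<partial>sample_law)
      \<le> ennreal (2 * (\<epsilon>\<^sup>2 / 96) + 2 * (\<epsilon>\<^sup>2 / 96))"
    by (intro nn_integral_norm_add_sq_le \<open>prob_space sample_law\<close>) auto
  then show ?thesis by (simp add: split)
qed

lemma index_batch_est_measurable:
  assumes [measurable]: "Y \<in> borel_measurable sample_law"
  shows "(\<lambda>w. coord_est \<mu> f (index_batch b w k) (Y w)) \<in> borel_measurable sample_law"
  unfolding coord_est_eq_average index_batch_eq
  by (simp add: image_mset.compositionality comp_def flip: sum_unfold_sum_mset)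
    (intro borel_measurable_scaleR borel_measurable_const borel_measurable_sum
      coord_quotient_measurable sample_measurable assms)

end

lemma online_spider_run:
  assumes smooth: "smooth_problem P f L" and "0 < L" "0 < \<epsilon>" and noise: "bounded_noise P f \<sigma>"
    and n0: "n0 \<in> online_n0_range CARD('d) \<sigma> \<epsilon>"
  shows "spider_run P (f :: 'i \<Rightarrow> real^'d \<Rightarrow> real) L \<epsilon> n0 (szo_mu CARD('d) L n0 \<epsilon>)
    (online_q \<sigma> n0 \<epsilon>) (online_S2 CARD('d) \<sigma> n0 \<epsilon>) (index_batch (online_S1' \<sigma> \<epsilon>))"
proof -
  interpret stochastic_objective P f L by standard fact+
  define d where "d = real CARD('d)"
  have n1: "1 \<le> n0" and "1 \<le> 30 * (2 * d + 9) * \<sigma> / \<epsilon>"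
    using n0 by (auto simp: online_n0_range_def d_def)
  then have "0 < 30 * (2 * d + 9) * \<sigma>" using \<open>0 < \<epsilon>\<close> by (simp add: pos_le_divide_eq)
  moreover have "0 < d" by (simp add: d_def)
  ultimately have \<sigma>: "0 < \<sigma>" by (simp add: zero_less_mult_iff)
  have mu: "0 < szo_mu CARD('d) L n0 \<epsilon>"
    "24 * (L * szo_mu CARD('d) L n0 \<epsilon>)\<^sup>2 * real CARD('d) \<le> \<epsilon>\<^sup>2"
    "6 * (L * szo_mu CARD('d) L n0 \<epsilon>)\<^sup>2 * n0\<^sup>2 * real CARD('d) ^ 3 \<le> \<epsilon>\<^sup>2"
    using szo_mu_bounds[OF \<open>0 < L\<close> \<open>0 < \<epsilon>\<close> n1, of "CARD('d)"] by (simp_all add: Suc_leI)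
  show ?thesis
  proof
    show "0 < online_q \<sigma> n0 \<epsilon>" "0 < online_S2 CARD('d) \<sigma> n0 \<epsilon>"
      using \<sigma> n1 \<open>0 < \<epsilon>\<close> by (simp_all add: online_q_def online_S2_def)
    have "6 * real (online_q \<sigma> n0 \<epsilon> - 1) * (2 * d + 9) \<le> 6 * (5 * n0 * \<sigma> / \<epsilon>) * (2 * d + 9)"
      unfolding online_q_def using \<sigma> n1 \<open>0 < \<epsilon>\<close> \<open>0 < d\<close>
      by (intro mult_right_mono mult_left_mono real_nat_ceiling_minus_one_le) auto
    also have "\<dots> = n0\<^sup>2 * (30 * (2 * d + 9) * \<sigma> / (\<epsilon> * n0))"
      using n1 \<open>0 < \<epsilon>\<close> by (simp add: field_simps power2_eq_square)
    also have "\<dots> \<le> n0\<^sup>2 * real (online_S2 CARD('d) \<sigma> n0 \<epsilon>)"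
      unfolding online_S2_def d_def by (intro mult_left_mono real_nat_ceiling_ge) simp
    finally show "6 * real (online_q \<sigma> n0 \<epsilon> - 1) * (2 * real CARD('d) + 9)
        \<le> n0\<^sup>2 * real (online_S2 CARD('d) \<sigma> n0 \<epsilon>)" by (simp add: d_def)
    show "index_batch (online_S1' \<sigma> \<epsilon>) (w((k', t) := p)) k = index_batch (online_S1' \<sigma> \<epsilon>) w k"
      if "k < k'" for w k k' t and p :: "'i \<times> (real^'d)"
      using that by (simp add: index_batch_eq)
    fix k and Y :: "(nat \<times> nat \<Rightarrow> 'i \<times> (real^'d)) \<Rightarrow> real^'d"
    assume Y: "Y \<in> borel_measurable sample_law"
    then show "(\<lambda>w. coord_est (szo_mu CARD('d) L n0 \<epsilon>) f (index_batch (online_S1' \<sigma> \<epsilon>) w k) (Y w))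
        \<in> borel_measurable sample_law"
      by (rule index_batch_est_measurable)
    assume "\<And>w t p. Y (w((k, t) := p)) = Y w"
    with Y show "(\<integral>\<^sup>+w. ennreal ((norm (coord_est (szo_mu CARD('d) L n0 \<epsilon>) f
        (index_batch (online_S1' \<sigma> \<epsilon>) w k) (Y w) - F' (Y w)))\<^sup>2) \<partial>sample_law) \<le> ennreal (\<epsilon>\<^sup>2 / 24)"
    proof (intro online_reset_error[OF noise _ _ mu(1,2)])
      show "0 < online_S1' \<sigma> \<epsilon>" using \<sigma> \<open>0 < \<epsilon>\<close> by (simp add: online_S1'_def)
      have "96 * \<sigma>\<^sup>2 / \<epsilon>\<^sup>2 \<le> real (online_S1' \<sigma> \<epsilon>)"
        unfolding online_S1'_def by (rule real_nat_ceiling_ge)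
      then show "96 * \<sigma>\<^sup>2 \<le> real (online_S1' \<sigma> \<epsilon>) * \<epsilon>\<^sup>2"
        using \<open>0 < \<epsilon>\<close> by (simp add: pos_divide_le_eq)
    qed auto
  qed (use n1 mu \<open>0 < \<epsilon>\<close> in auto)
qed

text \<open>
  The reset averages over all indices, so its only error is the discretization error.
\<close>

lemma finite_spider_run:
  assumes smooth: "smooth_problem (uniform_count_measure {1..n}) g L" and "0 < L" "0 < \<epsilon>"
    and n0: "n0 \<in> finite_n0_range n"
  shows "spider_run (uniform_count_measure {1..n}) (g :: nat \<Rightarrow> real^'d \<Rightarrow> real) L \<epsilon> n0
    (szo_mu CARD('d) L n0 \<epsilon>) (finite_q n n0) (finite_S2 CARD('d) n n0) (\<lambda>w k. mset_set {1..n})"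
proof -
  interpret stochastic_objective "uniform_count_measure {1..n}" g L by standard fact+
  have n1: "1 \<le> n0" and "6 \<le> sqrt (real n)" using n0 by (auto simp: finite_n0_range_def)
  then have n: "0 < n" "0 < sqrt (real n)" by (auto intro: gr0I)
  let ?\<mu> = "szo_mu CARD('d) L n0 \<epsilon>"
  let ?\<Omega> = "sample_law :: (nat \<times> nat \<Rightarrow> nat \<times> (real^'d)) measure"
  have mu: "0 < ?\<mu>" "24 * (L * ?\<mu>)\<^sup>2 * real CARD('d) \<le> \<epsilon>\<^sup>2"
    "6 * (L * ?\<mu>)\<^sup>2 * n0\<^sup>2 * real CARD('d) ^ 3 \<le> \<epsilon>\<^sup>2"
    using szo_mu_bounds[OF \<open>0 < L\<close> \<open>0 < \<epsilon>\<close> n1, of "CARD('d)"] by (simp_all add: Suc_leI)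
  have avg: "F' x = (1 / real n) *\<^sub>R (\<Sum>i\<in>#mset_set {1..n}. gradient (g i) x)" for x
    unfolding grad_F unfolding uniform_count_measure_def
    by (simp add: lebesgue_integral_point_measure_finite scaleR_sum_right flip: sum_unfold_sum_mset)
  have err: "(norm (coord_est ?\<mu> g (mset_set {1..n}) x - F' x))\<^sup>2 \<le> \<epsilon>\<^sup>2 / 24" for x
  proof -
    have "(norm (coord_est ?\<mu> g (mset_set {1..n}) x - F' x))\<^sup>2 \<le> (L * ?\<mu>)\<^sup>2 * real CARD('d) / 4"
      unfolding avg using coord_est_error[of "mset_set {1..n}" ?\<mu> x] mu n
      by (simp add: mset_set_empty_iff space_uniform_count_measure)
    then show ?thesis using mu(2) zero_le_power2[of \<epsilon>] by linarith
  qed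
  show ?thesis
  proof
    show "0 < finite_q n n0" "0 < finite_S2 CARD('d) n n0"
      using n1 n by (simp_all add: finite_q_def finite_S2_def add_pos_pos)
    have "6 * real (finite_q n n0 - 1) * (2 * real CARD('d) + 9)
        \<le> 6 * (n0 * sqrt (real n) / 6) * (2 * real CARD('d) + 9)"
      unfolding finite_q_def using n1 n
      by (intro mult_right_mono mult_left_mono real_nat_ceiling_minus_one_le) auto
    also have "\<dots> = n0\<^sup>2 * ((2 * real CARD('d) + 9) * sqrt (real n) / n0)"
      using n1 by (simp add: field_simps power2_eq_square)
    also have "\<dots> \<le> n0\<^sup>2 * real (finite_S2 CARD('d) n n0)"
      unfolding finite_S2_def by (intro mult_left_mono real_nat_ceiling_ge) simp
    finally show "6 * real (finite_q n n0 - 1) * (2 * real CARD('d) + 9)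
        \<le> n0\<^sup>2 * real (finite_S2 CARD('d) n n0)" .
    fix k and Y :: "(nat \<times> nat \<Rightarrow> nat \<times> (real^'d)) \<Rightarrow> real^'d"
    assume Y: "Y \<in> borel_measurable ?\<Omega>"
    have "(\<lambda>w. coord_quotient ?\<mu> (g i) (Y w)) \<in> borel_measurable ?\<Omega>" if "i \<in> {1..n}" for i
    proof (rule coord_quotient_measurable[of "\<lambda>_. i", OF measurable_const Y])
      show "i \<in> space (uniform_count_measure {1..n})"
        using that by (simp add: space_uniform_count_measure)
    qed
    then show "(\<lambda>w. coord_est ?\<mu> g (mset_set {1..n}) (Y w)) \<in> borel_measurable ?\<Omega>"
      unfolding coord_est_eq_average sum_unfold_sum_mset[symmetric]
      by (intro borel_measurable_scaleR borel_measurable_sum) auto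
    have "(\<integral>\<^sup>+w. ennreal ((norm (coord_est ?\<mu> g (mset_set {1..n}) (Y w) - F' (Y w)))\<^sup>2) \<partial>?\<Omega>)
        \<le> (\<integral>\<^sup>+w. ennreal (\<epsilon>\<^sup>2 / 24) \<partial>?\<Omega>)"
      by (intro nn_integral_mono ennreal_leI err)
    also have "\<dots> = ennreal (\<epsilon>\<^sup>2 / 24)"
      using prob_space.emeasure_space_1[OF prob_space_PiM[of "UNIV :: (nat \<times> nat) set" "\<lambda>_. M"]]
        M.prob_space_axioms by simp
    finally show "(\<integral>\<^sup>+w. ennreal ((norm (coord_est ?\<mu> g (mset_set {1..n}) (Y w) - F' (Y w)))\<^sup>2) \<partial>?\<Omega>)
        \<le> ennreal (\<epsilon>\<^sup>2 / 24)" .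
  qed (use n1 mu \<open>0 < \<epsilon>\<close> in auto)
qed
section \<open>The number of oracle calls\<close>

lemma izo_calls_eq_call_count:
  fixes f :: "'i \<Rightarrow> real^'d \<Rightarrow> real"
  assumes "\<And>k. size (B k) = b" and "\<And>k. size (S k) = s"
  shows "izo_calls f \<mu> \<eta> q B S x0 K = call_count CARD('d) b s q K"
proof -
  have "size (szo_queries f \<mu> \<eta> q B S x0 k) = (if q dvd k then 2 * CARD('d) * b else 4 * s)" for k
    by (simp add: szo_queries_def Let_def assms image_mset.compositionality comp_def case_prod_beta)
  then show ?thesis by (simp add: izo_calls_def call_count_def)
qed

lemma size_pair_batch: "size (pair_batch s w k) = s"
  by (simp add: pair_batch_def)

lemma size_index_batch: "size (index_batch b w k) = b"
  by (simp add: index_batch_def size_pair_batch)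

lemma call_count_le:
  assumes "0 < q"
  shows "real (call_count d b s q K) \<le> (real K / real q + 1) * (2 * real d * real b) + 4 * real K * real s"
proof -
  have "{k. k < K \<and> q dvd k} \<subseteq> (\<lambda>m. q * m) ` {..K div q}"
  proof
    fix k assume "k \<in> {k. k < K \<and> q dvd k}"
    then have "k = q * (k div q)" "k div q \<le> K div q" by (auto intro: div_le_mono)
    then show "k \<in> (\<lambda>m. q * m) ` {..K div q}" by blast
  qed
  then have "card {k. k < K \<and> q dvd k} \<le> K div q + 1"
    using surj_card_le[of "{..K div q}"] by fastforce
  then have "real (card {k. k < K \<and> q dvd k}) \<le> real (K div q) + 1" by linarith
  also have "\<dots> \<le> real K / real q + 1" by (intro add_right_mono of_nat_div_le_of_nat)
  finally have c: "real (card {k. k < K \<and> q dvd k}) \<le> real K / real q + 1" .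
  have "call_count d b s q K \<le> (\<Sum>k<K. (if q dvd k then 2 * d * b else 0) + 4 * s)"
    unfolding call_count_def by (intro sum_mono) simp
  also have "\<dots> = card {k. k < K \<and> q dvd k} * (2 * d * b) + K * (4 * s)"
    by (simp add: sum.distrib sum.If_cases Int_def lessThan_def)
  finally have "real (call_count d b s q K) \<le> real (card {k. k < K \<and> q dvd k} * (2 * d * b) + K * (4 * s))"
    by (simp only: of_nat_le_iff)
  also have "\<dots> = real (card {k. k < K \<and> q dvd k}) * (2 * real d * real b) + 4 * real K * real s"
    by simp
  also have "\<dots> \<le> (real K / real q + 1) * (2 * real d * real b) + 4 * real K * real s"
    using c by (intro add_right_mono mult_right_mono) auto
  finally show ?thesis .
qed

lemma real_nat_ceiling_le_double: "1 \<le> x \<Longrightarrow> real (nat \<lceil>x\<rceil>) \<le> 2 * x"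
  by linarith

lemma szo_K_le:
  assumes "0 \<le> \<Delta>" "0 < L" "0 < \<epsilon>" "\<epsilon> \<le> 1" "1 \<le> n0"
  shows "real (szo_K L \<Delta> n0 \<epsilon>) \<le> (4 * L * \<Delta> + 1) * (n0 / \<epsilon>\<^sup>2)"
proof -
  have "0 \<le> 4 * L * \<Delta> * n0 / \<epsilon>\<^sup>2" using assms by simp
  then have "real (szo_K L \<Delta> n0 \<epsilon>) \<le> 4 * L * \<Delta> * n0 / \<epsilon>\<^sup>2 + 1" unfolding szo_K_def by linarith
  also have "1 \<le> n0 / \<epsilon>\<^sup>2"
    using assms power_le_one[of \<epsilon> 2] by (simp add: pos_le_divide_eq)
  finally show ?thesis by (simp add: algebra_simps)
qed

text \<open>
  There are at most \<open>K / q + 1\<close> resets, of order \<open>1 / \<epsilon>\<close> with \<open>b\<close> of order \<open>1 / \<epsilon>\<^sup>2\<close>, and \<open>K * s\<close> is of order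
  \<open>d / \<epsilon>\<^sup>3\<close> because \<open>n0\<close> cancels. The upper end of the range of \<open>n0\<close> keeps the unrounded \<open>s\<close> at
  least \<open>1\<close>, where rounding up costs at most a factor \<open>2\<close>. The factors \<open>660\<close> and \<open>2640\<close> come from
  \<open>2 d + 9 \<le> 11 d\<close>.
\<close>

lemma online_calls_le:
  assumes "0 \<le> \<Delta>" "0 < L" "0 < \<sigma>" "0 < \<epsilon>" "\<epsilon> \<le> 1" "1 \<le> d" and n0: "n0 \<in> online_n0_range d \<sigma> \<epsilon>"
  shows "real (online_calls d L \<Delta> \<sigma> n0 \<epsilon>)
    \<le> (2 * ((4 * L * \<Delta> + 1) / (5 * \<sigma>) + 1) * (96 * \<sigma>\<^sup>2 + 1) + 2640 * \<sigma> * (4 * L * \<Delta> + 1))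
      * (real d * (1 / \<epsilon> ^ 3))"
proof -
  define a where "a = 4 * L * \<Delta> + 1"
  define K q b s where "K = real (szo_K L \<Delta> n0 \<epsilon>)" and "q = real (online_q \<sigma> n0 \<epsilon>)"
    and "b = real (online_S1' \<sigma> \<epsilon>)" and "s = real (online_S2 d \<sigma> n0 \<epsilon>)"
  have a: "1 \<le> a" using assms by (simp add: a_def)
  have n1: "1 \<le> n0" and n2: "n0 \<le> 30 * (2 * real d + 9) * \<sigma> / \<epsilon>"
    using n0 by (auto simp: online_n0_range_def)
  have K: "K \<le> a * (n0 / \<epsilon>\<^sup>2)" unfolding K_def a_def by (rule szo_K_le) (use assms n1 in auto)
  have q: "5 * n0 * \<sigma> / \<epsilon> \<le> q" unfolding q_def online_q_def by (rule real_nat_ceiling_ge)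
  have q0: "0 < 5 * n0 * \<sigma> / \<epsilon>" using assms n1 by simp
  have "K / q \<le> a * (n0 / \<epsilon>\<^sup>2) / (5 * n0 * \<sigma> / \<epsilon>)"
    using K q q0 a assms n1 by (intro frac_le) auto
  also have "\<dots> = a / (5 * \<sigma>) / \<epsilon>" using assms n1 by (simp add: field_simps power2_eq_square)
  finally have "K / q + 1 \<le> a / (5 * \<sigma>) / \<epsilon> + 1 / \<epsilon>"
    using assms by (intro add_mono) (auto simp: pos_le_divide_eq)
  then have Kq: "K / q + 1 \<le> (a / (5 * \<sigma>) + 1) / \<epsilon>" by (simp add: add_divide_distrib)
  have "b \<le> 96 * \<sigma>\<^sup>2 / \<epsilon>\<^sup>2 + 1"
  proof -
    have "0 \<le> 96 * \<sigma>\<^sup>2 / \<epsilon>\<^sup>2" by simp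
    then show ?thesis unfolding b_def online_S1'_def by linarith
  qed
  also have "1 \<le> 1 / \<epsilon>\<^sup>2" using assms power_le_one[of \<epsilon> 2] by (simp add: pos_le_divide_eq)
  finally have b: "b \<le> (96 * \<sigma>\<^sup>2 + 1) / \<epsilon>\<^sup>2" by (simp add: add_divide_distrib)
  have "1 \<le> 30 * (2 * real d + 9) * \<sigma> / (\<epsilon> * n0)"
    using n2 n1 assms by (simp add: field_simps)
  then have "s \<le> 2 * (30 * (2 * real d + 9) * \<sigma> / (\<epsilon> * n0))"
    unfolding s_def online_S2_def by (rule real_nat_ceiling_le_double)
  also have "\<dots> \<le> 2 * (30 * (11 * real d) * \<sigma> / (\<epsilon> * n0))"
    using assms n1 by (intro mult_left_mono divide_right_mono mult_right_mono) auto
  finally have s: "s \<le> 660 * real d * \<sigma> / (\<epsilon> * n0)" by simp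
  have "real (online_calls d L \<Delta> \<sigma> n0 \<epsilon>) \<le> (K / q + 1) * (2 * real d * b) + 4 * K * s"
    unfolding online_calls_def K_def q_def b_def s_def
    by (rule call_count_le) (use q q0 in \<open>simp add: q_def\<close>)
  also have "\<dots> \<le> ((a / (5 * \<sigma>) + 1) / \<epsilon>) * (2 * real d * ((96 * \<sigma>\<^sup>2 + 1) / \<epsilon>\<^sup>2))
      + 4 * (a * (n0 / \<epsilon>\<^sup>2)) * (660 * real d * \<sigma> / (\<epsilon> * n0))"
    using Kq b K s a assms n1
    by (intro add_mono mult_mono mult_left_mono)
      (auto simp: K_def b_def s_def intro!: divide_nonneg_pos add_nonneg_nonneg mult_nonneg_nonneg)
  also have "\<dots> = (2 * (a / (5 * \<sigma>) + 1) * (96 * \<sigma>\<^sup>2 + 1) + 2640 * \<sigma> * a) * (real d * (1 / \<epsilon> ^ 3))"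
    using assms n1 by (simp add: field_simps power2_eq_square power3_eq_cube)
  finally show ?thesis by (simp only: a_def)
qed

text \<open>
  The reset at step \<open>0\<close> alone costs \<open>2 d n\<close> calls; this is of order \<open>d \<surd>n / \<epsilon>\<^sup>2\<close> exactly when \<open>\<surd>n\<close> is
  of order at most \<open>1 / \<epsilon>\<^sup>2\<close>.
\<close>

lemma finite_calls_le:
  assumes "0 \<le> \<Delta>" "0 < L" "0 < \<epsilon>" "\<epsilon> \<le> 1" "1 \<le> d" and n0: "n0 \<in> finite_n0_range n"
    and n: "real n \<le> 1 / \<epsilon> ^ 4"
  shows "real (finite_calls d n L \<Delta> n0 \<epsilon>)
    \<le> (2 * (6 * (4 * L * \<Delta> + 1) + 1) + 88 * (4 * L * \<Delta> + 1)) * (real d * (sqrt (real n) / \<epsilon>\<^sup>2))"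
proof -
  define a r where "a = 4 * L * \<Delta> + 1" and "r = sqrt (real n)"
  define K q s where "K = real (szo_K L \<Delta> n0 \<epsilon>)" and "q = real (finite_q n n0)"
    and "s = real (finite_S2 d n n0)"
  have a: "1 \<le> a" using assms by (simp add: a_def)
  have n1: "1 \<le> n0" and n2: "n0 \<le> r / 6" using n0 by (auto simp: finite_n0_range_def r_def)
  then have r: "6 \<le> r" by simp
  have rr: "real n = r * r" by (simp add: r_def)
  have "r \<le> sqrt (1 / \<epsilon> ^ 4)" unfolding r_def using n by (rule real_sqrt_le_mono)
  also have "\<dots> = 1 / \<epsilon>\<^sup>2"
    using real_sqrt_abs[of "1 / \<epsilon>\<^sup>2"] by (simp add: power_divide flip: power_mult)
  finally have "r * r \<le> r * (1 / \<epsilon>\<^sup>2)" using r by (intro mult_left_mono) auto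
  then have nr: "real n \<le> r / \<epsilon>\<^sup>2" by (simp add: rr)
  have K: "K \<le> a * (n0 / \<epsilon>\<^sup>2)" unfolding K_def a_def by (rule szo_K_le) (use assms n1 in auto)
  have q: "n0 * r / 6 \<le> q" unfolding q_def finite_q_def r_def by (rule real_nat_ceiling_ge)
  have q0: "0 < n0 * r / 6" using n1 r by simp
  have "K / q \<le> a * (n0 / \<epsilon>\<^sup>2) / (n0 * r / 6)"
    using K q q0 a assms n1 by (intro frac_le) auto
  also have "\<dots> = 6 * a / \<epsilon>\<^sup>2 / r" using n1 by (simp add: field_simps)
  finally have "(K / q + 1) * (2 * real d * real n) \<le> (6 * a / \<epsilon>\<^sup>2 / r + 1) * (2 * real d * real n)"
    by (intro mult_right_mono) auto
  also have "\<dots> = 2 * real d * (6 * a * r / \<epsilon>\<^sup>2 + real n)"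
    using r by (simp add: field_simps rr)
  also have "\<dots> \<le> 2 * real d * (6 * a * r / \<epsilon>\<^sup>2 + r / \<epsilon>\<^sup>2)"
    by (intro mult_left_mono add_left_mono nr) simp
  finally have 1: "(K / q + 1) * (2 * real d * real n) \<le> 2 * real d * (6 * a * r / \<epsilon>\<^sup>2 + r / \<epsilon>\<^sup>2)" .
  have "n0 * 1 \<le> r * (2 * real d + 9)" using n2 r by (intro mult_mono) auto
  then have "1 \<le> (2 * real d + 9) * r / n0"
    using n1 by (simp add: pos_le_divide_eq mult.commute)
  then have "s \<le> 2 * ((2 * real d + 9) * r / n0)"
    unfolding s_def finite_S2_def r_def by (rule real_nat_ceiling_le_double)
  also have "\<dots> \<le> 2 * (11 * real d * r / n0)"
    using assms n1 r by (intro mult_left_mono divide_right_mono mult_right_mono) auto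
  finally have s: "s \<le> 22 * real d * r / n0" by simp
  have "real (finite_calls d n L \<Delta> n0 \<epsilon>) \<le> (K / q + 1) * (2 * real d * real n) + 4 * K * s"
    unfolding finite_calls_def K_def q_def s_def
    by (rule call_count_le) (use q q0 in \<open>simp add: q_def\<close>)
  also have "\<dots> \<le> 2 * real d * (6 * a * r / \<epsilon>\<^sup>2 + r / \<epsilon>\<^sup>2) + 4 * (a * (n0 / \<epsilon>\<^sup>2)) * (22 * real d * r / n0)"
    using K s a n1 by (intro add_mono 1 mult_mono mult_left_mono) (auto simp: s_def)
  also have "\<dots> = (2 * (6 * a + 1) + 88 * a) * (real d * (r / \<epsilon>\<^sup>2))"
    using assms n1 by (simp add: field_simps)
  finally show ?thesis by (simp only: a_def r_def)
qed

text \<open>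
  The two rates agree for \<open>\<surd>n = 1 / \<epsilon>\<close>. Below this value the finite-sum rate is the better one, and \<open>n\<close> is
  then small enough for \<open>finite_calls_le\<close>; above it the on-line rate is.
\<close>

lemma calls_bound:
  assumes "0 \<le> \<Delta>" "0 < L" "0 < \<sigma>"
  shows "\<exists>C>0. \<forall>d\<ge>1. \<forall>\<epsilon>::real. 0 < \<epsilon> \<longrightarrow> \<epsilon> \<le> 1 \<longrightarrow>
    (\<forall>n0\<in>online_n0_range d \<sigma> \<epsilon>.
       real (online_calls d L \<Delta> \<sigma> n0 \<epsilon>) \<le> C * (real d * (1 / \<epsilon>^3))) \<and>
    (\<forall>n. \<forall>n0\<in>finite_n0_range n. real n \<le> 1 / \<epsilon>^4 \<longrightarrow>
       real (finite_calls d n L \<Delta> n0 \<epsilon>) \<le> C * (real d * (sqrt (real n) / \<epsilon>\<^sup>2))) \<and>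
    (\<forall>n. \<forall>n0\<in>finite_n0_range n. \<forall>n0'\<in>online_n0_range d \<sigma> \<epsilon>.
       min (real (finite_calls d n L \<Delta> n0 \<epsilon>)) (real (online_calls d L \<Delta> \<sigma> n0' \<epsilon>))
         \<le> C * (real d * min (sqrt (real n) / \<epsilon>\<^sup>2) (1 / \<epsilon>^3)))"
proof -
  define A where "A = 2 * ((4 * L * \<Delta> + 1) / (5 * \<sigma>) + 1) * (96 * \<sigma>\<^sup>2 + 1) + 2640 * \<sigma> * (4 * L * \<Delta> + 1)"
  define A' where "A' = 2 * (6 * (4 * L * \<Delta> + 1) + 1) + 88 * (4 * L * \<Delta> + 1)"
  have pos: "0 < A" "0 < A'"
    unfolding A_def A'_def using assms by (auto intro!: add_pos_pos mult_pos_pos add_nonneg_pos divide_pos_pos)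
  have online: "real (online_calls d L \<Delta> \<sigma> n0 \<epsilon>) \<le> (A + A') * (real d * (1 / \<epsilon>^3))"
    if "1 \<le> d" "0 < \<epsilon>" "\<epsilon> \<le> 1" "n0 \<in> online_n0_range d \<sigma> \<epsilon>" for d \<epsilon> n0
  proof -
    have "real (online_calls d L \<Delta> \<sigma> n0 \<epsilon>) \<le> A * (real d * (1 / \<epsilon>^3))"
      unfolding A_def by (rule online_calls_le) (use assms that in auto)
    also have "\<dots> \<le> (A + A') * (real d * (1 / \<epsilon>^3))" using pos that by (intro mult_right_mono) auto
    finally show ?thesis .
  qed
  have finite: "real (finite_calls d n L \<Delta> n0 \<epsilon>) \<le> (A + A') * (real d * (sqrt (real n) / \<epsilon>\<^sup>2))"
    if "1 \<le> d" "0 < \<epsilon>" "\<epsilon> \<le> 1" "n0 \<in> finite_n0_range n" "real n \<le> 1 / \<epsilon>^4" for d n \<epsilon> n0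
  proof -
    have "real (finite_calls d n L \<Delta> n0 \<epsilon>) \<le> A' * (real d * (sqrt (real n) / \<epsilon>\<^sup>2))"
      unfolding A'_def by (rule finite_calls_le) (use assms that in auto)
    also have "\<dots> \<le> (A + A') * (real d * (sqrt (real n) / \<epsilon>\<^sup>2))" using pos that by (intro mult_right_mono) auto
    finally show ?thesis .
  qed
  have both: "min (real (finite_calls d n L \<Delta> n0 \<epsilon>)) (real (online_calls d L \<Delta> \<sigma> n0' \<epsilon>))
      \<le> (A + A') * (real d * min (sqrt (real n) / \<epsilon>\<^sup>2) (1 / \<epsilon>^3))"
    if h: "1 \<le> d" "0 < \<epsilon>" "\<epsilon> \<le> 1" "n0 \<in> finite_n0_range n" "n0' \<in> online_n0_range d \<sigma> \<epsilon>" for d n \<epsilon> n0 n0'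
  proof (cases "sqrt (real n) \<le> 1 / \<epsilon>")
    case True
    then have "sqrt (real n) / \<epsilon>\<^sup>2 \<le> 1 / \<epsilon> / \<epsilon>\<^sup>2" by (rule divide_right_mono) simp
    then have m: "min (sqrt (real n) / \<epsilon>\<^sup>2) (1 / \<epsilon>^3) = sqrt (real n) / \<epsilon>\<^sup>2"
      by (simp add: power2_eq_square power3_eq_cube)
    have "real n \<le> (1 / \<epsilon>)\<^sup>2" using True by (rule sqrt_le_D)
    also have "\<dots> \<le> 1 / \<epsilon> ^ 4"
      using h power_decreasing[of 2 4 \<epsilon>] by (simp add: power_divide frac_le)
    finally show ?thesis using finite[OF h(1-4)] unfolding m by (simp add: min.coboundedI1)
  next
    case False
    then have "1 / \<epsilon> / \<epsilon>\<^sup>2 \<le> sqrt (real n) / \<epsilon>\<^sup>2" by (intro divide_right_mono) auto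
    then have m: "min (sqrt (real n) / \<epsilon>\<^sup>2) (1 / \<epsilon>^3) = 1 / \<epsilon>^3"
      by (simp add: power2_eq_square power3_eq_cube min_absorb2)
    show ?thesis using online[OF h(1-3,5)] unfolding m by (simp add: min.coboundedI2)
  qed
  show ?thesis
    by (rule exI[of _ "A + A'"]) (use pos online finite both in auto)
qed

section \<open>Convergence and complexity of SPIDER-SZO\<close>

theorem theorem8:
  fixes P :: "'i measure"
    and f :: "'i \<Rightarrow> real^'d \<Rightarrow> real"
    and g :: "nat \<Rightarrow> real^'d \<Rightarrow> real"
    and x0 :: "real^'d"
    and L \<epsilon> :: real
  assumes "0 < L" and "0 < \<epsilon>"
  shows
    "(\<forall>\<sigma> n0. smooth_problem P f L \<longrightarrow> bounded_noise P f \<sigma> \<longrightarrow>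
        n0 \<in> online_n0_range CARD('d) \<sigma> \<epsilon> \<longrightarrow>
        (let \<Delta> = initial_gap P f x0;
             \<mu> = szo_mu CARD('d) L n0 \<epsilon>;
             \<eta> = szo_eta L n0 \<epsilon>;
             K = szo_K L \<Delta> n0 \<epsilon>;
             q = online_q \<sigma> n0 \<epsilon>;
             B = index_batch (online_S1' \<sigma> \<epsilon>);
             S = pair_batch (online_S2 CARD('d) \<sigma> n0 \<epsilon>);
             G = (\<lambda>(\<omega>, k). norm (gradient (objective P f)
                             (szo_iterate f \<mu> \<eta> q (B \<omega>) (S \<omega>) x0 k)))
         in integrable (szo_law P K) G \<and>
            (\<integral>\<xi>. G \<xi> \<partial>szo_law P K) \<le> 6 * \<epsilon> \<and>
            (\<forall>\<omega>. izo_calls f \<mu> \<eta> q (B \<omega>) (S \<omega>) x0 K = online_calls CARD('d) L \<Delta> \<sigma> n0 \<epsilon>))) \<and>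
     (\<forall>n n0. smooth_problem (uniform_count_measure {1..n}) g L \<longrightarrow>
        n0 \<in> finite_n0_range n \<longrightarrow>
        (let P' = uniform_count_measure {1..n};
             \<Delta> = initial_gap P' g x0;
             \<mu> = szo_mu CARD('d) L n0 \<epsilon>;
             \<eta> = szo_eta L n0 \<epsilon>;
             K = szo_K L \<Delta> n0 \<epsilon>;
             q = finite_q n n0;
             B = (\<lambda>k. mset_set {1..n});
             S = pair_batch (finite_S2 CARD('d) n n0);
             G = (\<lambda>(\<omega>, k). norm (gradient (objective P' g)
                             (szo_iterate g \<mu> \<eta> q B (S \<omega>) x0 k)))
         in integrable (szo_law P' K) G \<and>
            (\<integral>\<xi>. G \<xi> \<partial>szo_law P' K) \<le> 6 * \<epsilon> \<and>
            (\<forall>\<omega>. izo_calls g \<mu> \<eta> q B (S \<omega>) x0 K = finite_calls CARD('d) n L \<Delta> n0 \<epsilon>))) \<and>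
     (\<forall>\<Delta>\<ge>0. \<forall>L>0. \<forall>\<sigma>>0. \<exists>C>0. \<forall>d\<ge>1. \<forall>\<epsilon>::real. 0 < \<epsilon> \<longrightarrow> \<epsilon> \<le> 1 \<longrightarrow>
        (\<forall>n0\<in>online_n0_range d \<sigma> \<epsilon>.
           real (online_calls d L \<Delta> \<sigma> n0 \<epsilon>) \<le> C * (real d * (1 / \<epsilon>^3))) \<and>
        (\<forall>n. \<forall>n0\<in>finite_n0_range n. real n \<le> 1 / \<epsilon>^4 \<longrightarrow>
           real (finite_calls d n L \<Delta> n0 \<epsilon>) \<le> C * (real d * (sqrt (real n) / \<epsilon>\<^sup>2))) \<and>
        (\<forall>n. \<forall>n0\<in>finite_n0_range n. \<forall>n0'\<in>online_n0_range d \<sigma> \<epsilon>.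
           min (real (finite_calls d n L \<Delta> n0 \<epsilon>)) (real (online_calls d L \<Delta> \<sigma> n0' \<epsilon>))
             \<le> C * (real d * min (sqrt (real n) / \<epsilon>\<^sup>2) (1 / \<epsilon>^3))))"
proof (intro conjI allI impI)
  fix \<sigma> n0
  assume P: "smooth_problem P f L" and noise: "bounded_noise P f \<sigma>"
    and n0: "n0 \<in> online_n0_range CARD('d) \<sigma> \<epsilon>"
  interpret spider_run P f L \<epsilon> n0 "szo_mu CARD('d) L n0 \<epsilon>" x0 "online_q \<sigma> n0 \<epsilon>"
    "online_S2 CARD('d) \<sigma> n0 \<epsilon>" "index_batch (online_S1' \<sigma> \<epsilon>)"
    by (rule online_spider_run) fact+
  show "let \<Delta> = initial_gap P f x0;
             \<mu> = szo_mu CARD('d) L n0 \<epsilon>;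
             \<eta> = szo_eta L n0 \<epsilon>;
             K = szo_K L \<Delta> n0 \<epsilon>;
             q = online_q \<sigma> n0 \<epsilon>;
             B = index_batch (online_S1' \<sigma> \<epsilon>);
             S = pair_batch (online_S2 CARD('d) \<sigma> n0 \<epsilon>);
             G = (\<lambda>(\<omega>, k). norm (gradient (objective P f)
                             (szo_iterate f \<mu> \<eta> q (B \<omega>) (S \<omega>) x0 k)))
         in integrable (szo_law P K) G \<and>
            (\<integral>\<xi>. G \<xi> \<partial>szo_law P K) \<le> 6 * \<epsilon> \<and>
            (\<forall>\<omega>. izo_calls f \<mu> \<eta> q (B \<omega>) (S \<omega>) x0 K = online_calls CARD('d) L \<Delta> \<sigma> n0 \<epsilon>)"
    unfolding Let_def online_calls_def szo_iterate_def X_def[symmetric]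
    by (intro conjI allI izo_calls_eq_call_count expected_output_gradient szo_K_ge assms)
      (simp_all add: size_index_batch size_pair_batch szo_K_def)
next
  fix n n0
  assume P: "smooth_problem (uniform_count_measure {1..n}) g L" and n0: "n0 \<in> finite_n0_range n"
  interpret spider_run "uniform_count_measure {1..n}" g L \<epsilon> n0 "szo_mu CARD('d) L n0 \<epsilon>" x0
    "finite_q n n0" "finite_S2 CARD('d) n n0" "\<lambda>w k. mset_set {1..n}"
    by (rule finite_spider_run) fact+
  show "let P' = uniform_count_measure {1..n};
             \<Delta> = initial_gap P' g x0;
             \<mu> = szo_mu CARD('d) L n0 \<epsilon>;
             \<eta> = szo_eta L n0 \<epsilon>;
             K = szo_K L \<Delta> n0 \<epsilon>;
             q = finite_q n n0;
             B = (\<lambda>k. mset_set {1..n});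
             S = pair_batch (finite_S2 CARD('d) n n0);
             G = (\<lambda>(\<omega>, k). norm (gradient (objective P' g)
                             (szo_iterate g \<mu> \<eta> q B (S \<omega>) x0 k)))
         in integrable (szo_law P' K) G \<and>
            (\<integral>\<xi>. G \<xi> \<partial>szo_law P' K) \<le> 6 * \<epsilon> \<and>
            (\<forall>\<omega>. izo_calls g \<mu> \<eta> q B (S \<omega>) x0 K = finite_calls CARD('d) n L \<Delta> n0 \<epsilon>)"
    unfolding Let_def finite_calls_def szo_iterate_def X_def[symmetric]
    by (intro conjI allI izo_calls_eq_call_count expected_output_gradient szo_K_ge assms)
      (simp_all add: size_pair_batch szo_K_def)
qed (rule calls_bound)

end
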